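(* Let $0<\delta<\pi$, let $n\in\mathbb{N}$, and let $X=X(t,\omega)$ be a w.s.s. random process on a probability space $(\Omega,\mathscr{F},P)$ whose autocorrelation function $R_X$ belongs to $\mathcal{B}_\delta$ and is not identically zero. The coefficient functions $\mathbf{c}=(c_j: j\in J_n)$ on $(0,1)$ that minimize, for each $t\in(0,1)$, the quantity $$\Bigl\|X(t,\cdot)-\sum_{j\in J_n}c_j(t)X(j,\cdot)\Bigr\|_{L^2(\Omega,dP(\omega))}$$ are given by $$\mathbf{c}(t)=(R_X(t,j):j\in J_n)\,(R_X[J_n])^{-1},\qquad t\in(0,1),$$ and with these optimal coefficients the intrinsic error has the form $$\sup\Bigl\{\Bigl\|X(t,\cdot)-\sum_{j\in J_n}c_j(t)X(j,\cdot)\Bigr\|_{L^2(\Omega,dP(\omega))}:t\in(0,1)\Bigr\}=\mathcal{E}_n(R_X).$$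
   Context: $\mathbb{N}$ denotes the positive integers and $J_n:=\{j\in\mathbb{Z}:-n+1\le j\le n\}$. The Fourier transform is $\hat f(\xi)=\frac1{\sqrt{2\pi}}\int_{\mathbb{R}}f(t)e^{-it\xi}dt$. $\mathcal{B}_\delta$ is the Paley-Wiener space of functions $f\in C(\mathbb{R})\cap L^2(\mathbb{R})$ with Fourier transform supported on $[-\delta,\delta]$. A random process $X$ is w.s.s. (wide sense stationary) if $X(t,\cdot)\in L^2(\Omega,dP)$ for every $t\in\mathbb{R}$ and its autocorrelation $R_X(t,\tau):=\int_\Omega X(t,\omega)\overline{X(\tau,\omega)}\,dP(\omega)$ depends only on $t-\tau$; one writes $R_X(t):=R_X(t,0)$, and $R_X\in\mathcal{B}_\delta$ means that this one-variable function is in $\mathcal{B}_\delta$. In that case $R_X(t,\tau)=\int_{-\delta}^{\delta}e^{i(t-\tau)\xi}\rho(\xi)\,d\xi$ for some nonnegative $\rho\in L^2([-\delta,\delta])$ (and $R_X\not\equiv 0$ means $\|\rho\|_{L^2([-\delta,\delta])}>0$). $(R_X(t,j):j\in J_n)$ is a row vector and $R_X[J_n]:=[R_X(j,k):j,k\in J_n]$ is the $2n\times 2n$ kernel matrix. A function $K:\mathbb{R}\times\mathbb{R}\to\mathbb{C}$ is positive-definite if all matrices $[K(t_j,t_k)]$ (finitely many distinct points) are hermitian and positive semi-definite; then $\mathcal{H}_K$ denotes the unique reproducing kernel Hilbert space of functions on $\mathbb{R}$ with $K(t,\cdot)\in\mathcal{H}_K$ and $f(t)=\langle f,K(t,\cdot)\rangle_{\mathcal{H}_K}$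 for all $f\in\mathcal{H}_K$, $t\in\mathbb{R}$. $R_X(t,\tau)$ is such a kernel. $U(\mathcal{H})$ denotes the closed unit ball of a Hilbert space $\mathcal{H}$, and $\mathbb{C}^{J_n}$ the set of functions $J_n\to\mathbb{C}$. For a continuous translation-invariant reproducing kernel $K$ and a mapping $\mathcal{A}:\mathbb{C}^{J_n}\to L^\infty([0,1])$, put $\mathcal{E}_n(\mathcal{A},K):=\sup\{\|f-\mathcal{A}(f|_{J_n})\|_{L^\infty([0,1])}:f\in U(\mathcal{H}_K)\}$ and $\mathcal{E}_n(K):=\inf_{\mathcal{A}}\mathcal{E}_n(\mathcal{A},K)$, the infimum over all such mappings $\mathcal{A}$. It is known (and may be used as an equivalent definition) that $\mathcal{E}_n(K)=\sup\{\|f\|_{L^\infty([0,1])}:f\in U(\mathcal{H}_K),\ f(j)=0\ \forall j\in J_n\}$. *)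

theory Defs
  imports
    "HOL-Probability.Probability"
    "Jordan_Normal_Form.Gauss_Jordan_Elimination"
begin

section \<open>The Paley-Wiener space\<close>

definition square_integrable :: "'a measure \<Rightarrow> ('a \<Rightarrow> complex) \<Rightarrow> bool" where
  "square_integrable M f \<longleftrightarrow>
     f \<in> borel_measurable M \<and> integrable M (\<lambda>x. (norm (f x))\<^sup>2)"

definition L2_norm :: "'a measure \<Rightarrow> ('a \<Rightarrow> complex) \<Rightarrow> real" where
  "L2_norm M f = sqrt (\<integral>x. (norm (f x))\<^sup>2 \<partial>M)"

definition fourier_integral :: "(real \<Rightarrow> complex) \<Rightarrow> real \<Rightarrow> complex" where
  "fourier_integral f \<xi> =
     complex_of_real (1 / sqrt (2 * pi)) * (\<integral>t. f t * exp (- \<i> * of_real t * of_real \<xi>) \<partial>lborel)"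

text \<open>
  A square integrable function on the line need not be integrable, so its Fourier transform is the
  limit in \<open>L\<^sup>2\<close> of the Fourier integrals of its truncations; it is determined up to null sets.
  The distance is a nonnegative Lebesgue integral so that divergent integrals count as infinite.
\<close>
definition has_L2_fourier_transform ::
    "(real \<Rightarrow> complex) \<Rightarrow> (real \<Rightarrow> complex) \<Rightarrow> bool" where
  "has_L2_fourier_transform f g \<longleftrightarrow>
     square_integrable lborel g \<and>
     ((\<lambda>T. \<integral>\<^sup>+\<xi>. ennreal ((norm (g \<xi> -
           fourier_integral (\<lambda>t. indicator {-T..T} t * f t) \<xi>))\<^sup>2) \<partial>lborel)
        \<longlongrightarrow> 0) at_top"

definition paley_wiener :: "real \<Rightarrow> (real \<Rightarrow> complex) set" where
  "paley_wiener \<delta> =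
     {f. continuous_on UNIV f \<and> square_integrable lborel f \<and>
         (\<exists>g. has_L2_fourier_transform f g \<and> (AE \<xi> in lborel. \<xi> \<notin> {-\<delta>..\<delta>} \<longrightarrow> g \<xi> = 0))}"

section \<open>Wide sense stationary processes\<close>

definition autocorrelation ::
    "'w measure \<Rightarrow> (real \<Rightarrow> 'w \<Rightarrow> complex) \<Rightarrow> real \<Rightarrow> real \<Rightarrow> complex" where
  "autocorrelation M X t \<tau> = (\<integral>\<omega>. X t \<omega> * cnj (X \<tau> \<omega>) \<partial>M)"

definition wide_sense_stationary :: "'w measure \<Rightarrow> (real \<Rightarrow> 'w \<Rightarrow> complex) \<Rightarrow> bool" where
  "wide_sense_stationary M X \<longleftrightarrow>
     (\<forall>t. square_integrable M (X t)) \<and>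
     (\<forall>s \<sigma> t \<tau>. s - \<sigma> = t - \<tau> \<longrightarrow> autocorrelation M X s \<sigma> = autocorrelation M X t \<tau>)"

section \<open>Reproducing kernel Hilbert spaces\<close>

text \<open>
  The inner product is linear in its first argument.  Only its values on \<open>H \<times> H\<close> are relevant.
\<close>
locale hilbert_function_space =
  fixes H :: "('t \<Rightarrow> complex) set"
    and ip :: "('t \<Rightarrow> complex) \<Rightarrow> ('t \<Rightarrow> complex) \<Rightarrow> complex"
  assumes zero_mem: "(\<lambda>_. 0) \<in> H"
    and add_mem: "\<lbrakk>f \<in> H; g \<in> H\<rbrakk> \<Longrightarrow> (\<lambda>t. f t + g t) \<in> H"
    and scale_mem: "f \<in> H \<Longrightarrow> (\<lambda>t. a * f t) \<in> H"
    and ip_add: "\<lbrakk>f \<in> H; g \<in> H; h \<in> H\<rbrakk> \<Longrightarrow> ip (\<lambda>t. f t + g t) h = ip f h + ip g h"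
    and ip_scale: "\<lbrakk>f \<in> H; h \<in> H\<rbrakk> \<Longrightarrow> ip (\<lambda>t. a * f t) h = a * ip f h"
    and ip_commute: "\<lbrakk>f \<in> H; g \<in> H\<rbrakk> \<Longrightarrow> ip g f = cnj (ip f g)"
    and ip_nonneg: "f \<in> H \<Longrightarrow> 0 \<le> Re (ip f f)"
    and ip_definite: "\<lbrakk>f \<in> H; ip f f = 0\<rbrakk> \<Longrightarrow> f = (\<lambda>_. 0)"
    and complete:
      "\<lbrakk>\<And>k. u k \<in> H;
        \<And>e. e > 0 \<Longrightarrow> \<exists>N. \<forall>k\<ge>N. \<forall>l\<ge>N.
           sqrt (Re (ip (\<lambda>t. u k t - u l t) (\<lambda>t. u k t - u l t))) < e\<rbrakk>
       \<Longrightarrow> \<exists>f\<in>H. (\<lambda>k. sqrt (Re (ip (\<lambda>t. u k t - f t) (\<lambda>t. u k t - f t)))) \<longlonglongrightarrow> 0"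

locale reproducing_kernel_hilbert_space = hilbert_function_space H ip
  for K :: "'t \<Rightarrow> 't \<Rightarrow> complex"
    and H :: "('t \<Rightarrow> complex) set"
    and ip :: "('t \<Rightarrow> complex) \<Rightarrow> ('t \<Rightarrow> complex) \<Rightarrow> complex" +
  assumes kernel_mem: "K t \<in> H"
    and reproducing: "f \<in> H \<Longrightarrow> f t = ip f (K t)"

text \<open>
  For a positive-definite kernel the space and the inner product on it are unique
  (Moore-Aronszajn).  The choice operator is used instead of a definite description because
  the values of \<open>ip\<close> outside \<open>H \<times> H\<close> are arbitrary.
\<close>
definition rkhs ::
    "('t \<Rightarrow> 't \<Rightarrow> complex) \<Rightarrow>
     ('t \<Rightarrow> complex) set \<times> (('t \<Rightarrow> complex) \<Rightarrow> ('t \<Rightarrow> complex) \<Rightarrow> complex)" where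
  "rkhs K = (SOME (H, ip). reproducing_kernel_hilbert_space K H ip)"

definition rkhs_unit_ball :: "('t \<Rightarrow> 't \<Rightarrow> complex) \<Rightarrow> ('t \<Rightarrow> complex) set" where
  "rkhs_unit_ball K = {f \<in> fst (rkhs K). sqrt (Re (snd (rkhs K) f f)) \<le> 1}"

section \<open>Intrinsic errors\<close>

definition J :: "nat \<Rightarrow> int set" where
  "J n = {- int n + 1..int n}"

definition Linf_norm :: "(real \<Rightarrow> complex) \<Rightarrow> ennreal" where
  "Linf_norm f = esssup (lebesgue_on {0..1}) (\<lambda>t. ennreal (norm (f t)))"

definition Linf :: "(real \<Rightarrow> complex) set" where
  "Linf = {f \<in> borel_measurable (lebesgue_on {0..1}). Linf_norm f < \<infinity>}"

text \<open>
  Mappings into \<open>L\<^sup>\<infinity>([0,1])\<close> are represented by a choice of a representative of each value.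
  Neither linearity nor continuity of \<open>A\<close> is required.
\<close>
definition recovery_error ::
    "nat \<Rightarrow> ((int \<Rightarrow> complex) \<Rightarrow> (real \<Rightarrow> complex)) \<Rightarrow> (real \<Rightarrow> real \<Rightarrow> complex) \<Rightarrow> ennreal" where
  "recovery_error n A K =
     (SUP f\<in>rkhs_unit_ball K. Linf_norm (\<lambda>t. f t - A (restrict (\<lambda>j. f (of_int j)) (J n)) t))"

definition intrinsic_error :: "nat \<Rightarrow> (real \<Rightarrow> real \<Rightarrow> complex) \<Rightarrow> ennreal" where
  "intrinsic_error n K =
     (INF A \<in> (J n \<rightarrow>\<^sub>E (UNIV :: complex set)) \<rightarrow> Linf. recovery_error n A K)"

section \<open>Vectors and matrices indexed by \<open>J n\<close>\<close>

definition J_elem :: "nat \<Rightarrow> nat \<Rightarrow> int" where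
  "J_elem n i = int i - int n + 1"

lemma bij_betw_J_elem: "bij_betw (J_elem n) {..<2 * n} (J n)"
  by (rule bij_betwI[where g = "\<lambda>j. nat (j + int n - 1)"]) (auto simp: J_elem_def J_def)

definition row_on_J :: "nat \<Rightarrow> (int \<Rightarrow> complex) \<Rightarrow> complex Matrix.mat" where
  "row_on_J n v = Matrix.mat 1 (2 * n) (\<lambda>(_, k). v (J_elem n k))"

definition kernel_matrix :: "nat \<Rightarrow> (real \<Rightarrow> real \<Rightarrow> complex) \<Rightarrow> complex Matrix.mat" where
  "kernel_matrix n K =
     Matrix.mat (2 * n) (2 * n) (\<lambda>(i, k). K (of_int (J_elem n i)) (of_int (J_elem n k)))"

text \<open>Meaningful only for invertible matrices.\<close>
definition matrix_inverse :: "complex Matrix.mat \<Rightarrow> complex Matrix.mat" where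
  "matrix_inverse A = the (mat_inverse A)"

section \<open>Linear approximation of a process from its samples\<close>

definition approximation_error ::
    "'w measure \<Rightarrow> (real \<Rightarrow> 'w \<Rightarrow> complex) \<Rightarrow> nat \<Rightarrow> (int \<Rightarrow> complex) \<Rightarrow> real \<Rightarrow> real" where
  "approximation_error M X n a t =
     L2_norm M (\<lambda>\<omega>. X t \<omega> - (\<Sum>j\<in>J n. a j * X (of_int j) \<omega>))"

definition optimal_coefficients ::
    "'w measure \<Rightarrow> (real \<Rightarrow> 'w \<Rightarrow> complex) \<Rightarrow> nat \<Rightarrow> (int \<Rightarrow> real \<Rightarrow> complex) \<Rightarrow> bool" where
  "optimal_coefficients M X n c \<longleftrightarrow>
     (\<forall>t\<in>{0<..<1}. \<forall>a. approximation_error M X n (\<lambda>j. c j t) t \<le> approximation_error M X n a t)"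

end

theory Submission
  imports Defs
    "HOL-Computational_Algebra.Fundamental_Theorem_Algebra"
    "Jordan_Normal_Form.Determinant"
begin

text \<open>
  The statement compares two spaces that carry the same Gram kernel \<open>K\<close>, the autocorrelation:
  in \<open>L\<^sup>2\<close> of the probability space \<open>\<langle>X s, X t\<rangle> = K s t\<close>, and in the reproducing kernel space
  \<open>\<langle>K s, K t\<rangle> = K s t\<close>.  Distances between a vector and the span of finitely many others depend only
  on the Gram kernel.

  The minimization is a projection problem in \<open>L\<^sup>2\<close>.  Its solutions are the solutions of the normal
  equations \<open>\<Sum>\<^sub>j c\<^sub>j(t) K j k = K t k\<close> for \<open>k \<in> J n\<close> (\<open>best_approximation_iff\<close>), so everything
  about the coefficients follows once the kernel matrix is known to be invertible.  If it were
  singular, a nontrivial combination of the samples would vanish in \<open>L\<^sup>2\<close>.  By stationarity all its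
  translates would vanish too, and the autocorrelation function would satisfy a linear recurrence
  \<open>\<Sum>\<^sub>j a\<^sub>j R(t + j) = 0\<close> for all real \<open>t\<close>.  No continuous square integrable function except \<open>0\<close> does so
  (\<open>square_integrable_recurrence_zero\<close>): after factoring the characteristic polynomial this reduces
  to \<open>R(t + 1) = z R(t)\<close>, where \<open>\<bar>R\<bar>\<close> fails to decay in one of the two directions.

  For the error, let \<open>h t\<close> be the residual of the projection of \<open>K t\<close> in the reproducing kernel space.
  Its norm equals the optimal error at \<open>t\<close> by the comparison of Gram kernels.  That the supremum of
  \<open>\<parallel>h t\<parallel>\<close> over \<open>(0,1)\<close> is the intrinsic error is \<open>intrinsic_error_eq\<close>: the function
  \<open>h t / \<parallel>h t\<parallel>\<close> has zero samples and the value \<open>\<parallel>h t\<parallel>\<close> at \<open>t\<close>, which is a lower bound for every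
  recovery map, and the linear map built from the projection coefficients attains the bound.

  The reproducing kernel space enters through a choice, which is justified by constructing one such
  space from the process (\<open>rkhs_exists\<close> together with the completeness of \<open>L\<^sup>2\<close>).
\<close>

section \<open>Semi-inner product spaces of functions\<close>

text \<open>
  \<open>L\<^sup>2\<close> of a measure is only a seminormed space as long as functions are not identified up to null
  sets, whereas a reproducing kernel space is normed.  The arguments below compare the process in
  the first space with the kernel functions in the second, so the geometry they share is developed
  once, from the axioms that both satisfy.
\<close>
locale semi_inner_function_space =
  fixes S :: "('t \<Rightarrow> complex) set"
    and ip :: "('t \<Rightarrow> complex) \<Rightarrow> ('t \<Rightarrow> complex) \<Rightarrow> complex"
  assumes zero_in: "(\<lambda>_. 0) \<in> S"
    and add_in: "\<lbrakk>f \<in> S; g \<in> S\<rbrakk> \<Longrightarrow> (\<lambda>t. f t + g t) \<in> S"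
    and scale_in: "f \<in> S \<Longrightarrow> (\<lambda>t. a * f t) \<in> S"
    and ip_add_left: "\<lbrakk>f \<in> S; g \<in> S; h \<in> S\<rbrakk> \<Longrightarrow> ip (\<lambda>t. f t + g t) h = ip f h + ip g h"
    and ip_scale_left: "\<lbrakk>f \<in> S; h \<in> S\<rbrakk> \<Longrightarrow> ip (\<lambda>t. a * f t) h = a * ip f h"
    and ip_cnj: "\<lbrakk>f \<in> S; g \<in> S\<rbrakk> \<Longrightarrow> ip g f = cnj (ip f g)"
    and ip_self_nonneg: "f \<in> S \<Longrightarrow> 0 \<le> Re (ip f f)"
begin

definition nrm :: "('t \<Rightarrow> complex) \<Rightarrow> real" where
  "nrm f = sqrt (Re (ip f f))"

lemma nrm_nonneg: "f \<in> S \<Longrightarrow> 0 \<le> nrm f"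
  by (simp add: nrm_def ip_self_nonneg)

lemma ip_self: "f \<in> S \<Longrightarrow> ip f f = complex_of_real ((nrm f)\<^sup>2)"
  using arg_cong[OF ip_cnj[of f f], of Im] ip_self_nonneg[of f]
  by (simp add: complex_eq_iff nrm_def)

lemma diff_in: "\<lbrakk>f \<in> S; g \<in> S\<rbrakk> \<Longrightarrow> (\<lambda>t. f t - g t) \<in> S"
  using add_in[of f "\<lambda>t. (-1) * g t"] scale_in[of g "-1"] by simp

lemma ip_diff_left: "\<lbrakk>f \<in> S; g \<in> S; h \<in> S\<rbrakk> \<Longrightarrow> ip (\<lambda>t. f t - g t) h = ip f h - ip g h"
  using ip_add_left[of f "\<lambda>t. (-1) * g t" h] ip_scale_left[of g h "-1"] scale_in[of g "-1"] by simp

lemma ip_scale_right: "\<lbrakk>f \<in> S; h \<in> S\<rbrakk> \<Longrightarrow> ip h (\<lambda>t. a * f t) = cnj a * ip h f"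
  using ip_cnj[of "\<lambda>t. a * f t" h] ip_cnj[of f h] by (simp add: scale_in ip_scale_left)

lemma ip_diff_right: "\<lbrakk>f \<in> S; g \<in> S; h \<in> S\<rbrakk> \<Longrightarrow> ip h (\<lambda>t. f t - g t) = ip h f - ip h g"
  using ip_cnj[of "\<lambda>t. f t - g t" h] ip_cnj[of f h] ip_cnj[of g h]
  by (simp add: diff_in ip_diff_left)

lemma combination_in:
  assumes "finite I" "\<And>i. i \<in> I \<Longrightarrow> x i \<in> S"
  shows "(\<lambda>t. \<Sum>i\<in>I. a i * x i t) \<in> S"
  using assms by (induction I) (auto simp: zero_in intro!: add_in scale_in)

lemma ip_combination_left:
  assumes "finite I" "\<And>i. i \<in> I \<Longrightarrow> x i \<in> S" "h \<in> S"
  shows "ip (\<lambda>t. \<Sum>i\<in>I. a i * x i t) h = (\<Sum>i\<in>I. a i * ip (x i) h)"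
  using assms
proof (induction I)
  case empty
  then show ?case using ip_scale_left[OF zero_in, of h 0] by simp
next
  case (insert i I)
  then show ?case
    by (simp add: ip_add_left ip_scale_left scale_in combination_in)
qed

lemma ip_combination_right:
  assumes "finite I" "\<And>i. i \<in> I \<Longrightarrow> x i \<in> S" "h \<in> S"
  shows "ip h (\<lambda>t. \<Sum>i\<in>I. a i * x i t) = (\<Sum>i\<in>I. cnj (a i) * ip h (x i))"
proof -
  have "ip h (\<lambda>t. \<Sum>i\<in>I. a i * x i t) = cnj (\<Sum>i\<in>I. a i * ip (x i) h)"
    using ip_cnj[OF combination_in[OF assms(1,2)] assms(3)] ip_combination_left[OF assms]
    by simp
  also have "\<dots> = (\<Sum>i\<in>I. cnj (a i) * ip h (x i))"
    using assms(2,3) by (auto intro!: sum.cong simp: ip_cnj[of _ h])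
  finally show ?thesis .
qed

lemma nrm_diff_sqr:
  assumes "f \<in> S" "g \<in> S"
  shows "(nrm (\<lambda>t. f t - g t))\<^sup>2 = (nrm f)\<^sup>2 - 2 * Re (ip f g) + (nrm g)\<^sup>2"
proof -
  have "complex_of_real ((nrm (\<lambda>t. f t - g t))\<^sup>2) = ip (\<lambda>t. f t - g t) (\<lambda>t. f t - g t)"
    using assms by (simp add: ip_self diff_in)
  also have "\<dots> = ip f f - ip f g - cnj (ip f g) + ip g g"
    using assms ip_cnj[of f g] by (simp add: ip_diff_left ip_diff_right diff_in)
  finally have "complex_of_real ((nrm (\<lambda>t. f t - g t))\<^sup>2) =
     complex_of_real ((nrm f)\<^sup>2) - ip f g - cnj (ip f g) + complex_of_real ((nrm g)\<^sup>2)"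
    using assms by (simp add: ip_self)
  then show ?thesis
    by (simp add: complex_eq_iff)
qed

lemma nrm_scale: "f \<in> S \<Longrightarrow> nrm (\<lambda>t. a * f t) = norm a * nrm f"
proof -
  assume f: "f \<in> S"
  have "complex_of_real ((nrm (\<lambda>t. a * f t))\<^sup>2) = a * cnj a * complex_of_real ((nrm f)\<^sup>2)"
    using f by (simp add: ip_self[symmetric] scale_in ip_scale_left ip_scale_right del: of_real_power)
  also have "\<dots> = complex_of_real ((norm a * nrm f)\<^sup>2)"
    by (simp add: complex_norm_square[symmetric] power_mult_distrib)
  finally have "(nrm (\<lambda>t. a * f t))\<^sup>2 = (norm a * nrm f)\<^sup>2"
    using of_real_eq_iff by blast
  then show ?thesis
    using f by (simp add: nrm_nonneg scale_in)
qed

text \<open>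
  The quadratic polynomial \<open>s \<mapsto> \<parallel>f - s \<langle>f,g\<rangle> g\<parallel>\<^sup>2\<close> of the real variable \<open>s\<close> is nonnegative.  It is
  evaluated at its minimum if \<open>\<parallel>g\<parallel> > 0\<close>; if \<open>\<parallel>g\<parallel> = 0\<close> it is affine, so that its slope must vanish.
\<close>
lemma Cauchy_Schwarz:
  assumes f: "f \<in> S" and g: "g \<in> S"
  shows "norm (ip f g) \<le> nrm f * nrm g"
proof -
  define P where "P = (norm (ip f g))\<^sup>2"
  define F where "F = (nrm f)\<^sup>2"
  define G where "G = (nrm g)\<^sup>2"
  have quad: "0 \<le> F - 2 * s * P + s\<^sup>2 * P * G" for s :: real
  proof -
    let ?a = "of_real s * ip f g"
    have "0 \<le> (nrm (\<lambda>t. f t - ?a * g t))\<^sup>2" by simp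
    also have "\<dots> = F - 2 * Re (ip f (\<lambda>t. ?a * g t)) + (nrm (\<lambda>t. ?a * g t))\<^sup>2"
      by (simp add: nrm_diff_sqr f scale_in[OF g] F_def)
    also have "Re (ip f (\<lambda>t. ?a * g t)) = s * P"
    proof -
      have "ip f (\<lambda>t. ?a * g t) = of_real s * (ip f g * cnj (ip f g))"
        using ip_scale_right[OF g f, of ?a] by simp
      also have "\<dots> = of_real (s * P)"
        by (simp add: complex_norm_square[symmetric] P_def)
      finally show ?thesis by simp
    qed
    also have "(nrm (\<lambda>t. ?a * g t))\<^sup>2 = s\<^sup>2 * P * G"
      by (simp add: nrm_scale g norm_mult power_mult_distrib P_def G_def)
    finally show ?thesis by (simp add: mult_ac)
  qed
  have "P \<le> F * G"
  proof (cases "G = 0")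
    case True
    have "P = 0"
    proof (rule ccontr)
      assume "P \<noteq> 0"
      then have "P > 0" by (simp add: P_def)
      then show False using quad[of "(F + 1) / (2 * P)"] True by (simp add: F_def)
    qed
    then show ?thesis by (simp add: True)
  next
    case False
    then have "G > 0" by (simp add: G_def)
    then show ?thesis using quad[of "1 / G"] by (simp add: field_simps power2_eq_square)
  qed
  then have "(norm (ip f g))\<^sup>2 \<le> (nrm f * nrm g)\<^sup>2"
    by (simp add: P_def F_def G_def power_mult_distrib)
  then show ?thesis
    by (rule power2_le_imp_le) (simp add: nrm_nonneg f g)
qed

lemma ip_eq_0_if_nrm_0:
  assumes "f \<in> S" "g \<in> S" "nrm f = 0"
  shows "ip f g = 0"
  using Cauchy_Schwarz[OF assms(1,2)] assms(3) by simp

lemma nrm_0_iff: "f \<in> S \<Longrightarrow> nrm f = 0 \<longleftrightarrow> ip f f = 0"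
  by (simp add: ip_self)

lemma Pythagoras:
  assumes "finite I" "\<And>i. i \<in> I \<Longrightarrow> x i \<in> S" "y \<in> S"
    and orth: "\<And>k. k \<in> I \<Longrightarrow> ip (\<lambda>t. y t - (\<Sum>i\<in>I. c i * x i t)) (x k) = 0"
  shows "(nrm (\<lambda>t. y t - (\<Sum>i\<in>I. a i * x i t)))\<^sup>2 =
    (nrm (\<lambda>t. y t - (\<Sum>i\<in>I. c i * x i t)))\<^sup>2 + (nrm (\<lambda>t. \<Sum>i\<in>I. (a i - c i) * x i t))\<^sup>2"
proof -
  let ?r = "\<lambda>t. y t - (\<Sum>i\<in>I. c i * x i t)" and ?d = "\<lambda>t. \<Sum>i\<in>I. (a i - c i) * x i t"
  have r: "?r \<in> S" and d: "?d \<in> S"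
    using assms(1-3) by (intro diff_in combination_in; simp)+
  have "(\<lambda>t. y t - (\<Sum>i\<in>I. a i * x i t)) = (\<lambda>t. ?r t - ?d t)"
    by (simp add: algebra_simps sum_subtractf)
  moreover have "ip ?r ?d = 0"
    by (simp add: ip_combination_right assms(1,2) r orth)
  ultimately show ?thesis
    by (simp add: nrm_diff_sqr r d)
qed

text \<open>
  If one set of coefficients has an orthogonal residual then, by Pythagoras, every other minimizer
  differs from it by a combination of norm \<open>0\<close>.  Such a combination is orthogonal to everything, so
  the normal equations single out exactly the minimizers, even when the \<open>x i\<close> are dependent or the
  seminorm is degenerate.
\<close>
lemma best_approximation_iff:
  assumes fin: "finite I" and x: "\<And>i. i \<in> I \<Longrightarrow> x i \<in> S" and y: "y \<in> S"
    and solvable: "\<And>k. k \<in> I \<Longrightarrow> ip (\<lambda>t. y t - (\<Sum>i\<in>I. c0 i * x i t)) (x k) = 0"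
  shows "(\<forall>a. nrm (\<lambda>t. y t - (\<Sum>i\<in>I. c i * x i t)) \<le> nrm (\<lambda>t. y t - (\<Sum>i\<in>I. a i * x i t))) \<longleftrightarrow>
    (\<forall>k\<in>I. ip (\<lambda>t. y t - (\<Sum>i\<in>I. c i * x i t)) (x k) = 0)" (is "?min \<longleftrightarrow> ?orth")
proof
  have mem: "(\<lambda>t. y t - (\<Sum>i\<in>I. a i * x i t)) \<in> S" for a
    using fin x y by (intro diff_in combination_in) simp_all
  {
    assume ?orth
    show ?min
    proof
      fix a
      have "(nrm (\<lambda>t. y t - (\<Sum>i\<in>I. c i * x i t)))\<^sup>2 \<le> (nrm (\<lambda>t. y t - (\<Sum>i\<in>I. a i * x i t)))\<^sup>2"
        using Pythagoras[OF fin x y, where c = c and a = a] \<open>?orth\<close> by simp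
      then show "nrm (\<lambda>t. y t - (\<Sum>i\<in>I. c i * x i t)) \<le> nrm (\<lambda>t. y t - (\<Sum>i\<in>I. a i * x i t))"
        by (rule power2_le_imp_le) (simp add: nrm_nonneg mem)
    qed
  next
    assume ?min
    then have "nrm (\<lambda>t. y t - (\<Sum>i\<in>I. c i * x i t)) \<le> nrm (\<lambda>t. y t - (\<Sum>i\<in>I. c0 i * x i t))"
      by blast
    then have "(nrm (\<lambda>t. y t - (\<Sum>i\<in>I. c i * x i t)))\<^sup>2 \<le> (nrm (\<lambda>t. y t - (\<Sum>i\<in>I. c0 i * x i t)))\<^sup>2"
      by (rule power_mono) (simp add: nrm_nonneg mem)
    then have 0: "nrm (\<lambda>t. \<Sum>i\<in>I. (c i - c0 i) * x i t) = 0"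
      using Pythagoras[OF fin x y solvable, where a = c] by simp
    have d: "(\<lambda>t. \<Sum>i\<in>I. (c i - c0 i) * x i t) \<in> S"
      using fin x by (intro combination_in) simp_all
    show ?orth
    proof
      fix k assume k: "k \<in> I"
      have "(\<lambda>t. y t - (\<Sum>i\<in>I. c i * x i t)) =
          (\<lambda>t. (y t - (\<Sum>i\<in>I. c0 i * x i t)) - (\<Sum>i\<in>I. (c i - c0 i) * x i t))"
        by (simp add: algebra_simps sum_subtractf)
      then show "ip (\<lambda>t. y t - (\<Sum>i\<in>I. c i * x i t)) (x k) = 0"
        by (simp add: ip_diff_left mem d x k solvable ip_eq_0_if_nrm_0[OF d _ 0])
    qed
  }
qed

lemma ip_combinations:
  assumes "finite I" "\<And>i. i \<in> I \<Longrightarrow> x i \<in> S"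
  shows "ip (\<lambda>t. \<Sum>i\<in>I. a i * x i t) (\<lambda>t. \<Sum>i\<in>I. b i * x i t) =
    (\<Sum>i\<in>I. a i * (\<Sum>k\<in>I. cnj (b k) * ip (x i) (x k)))"
  using assms by (simp add: ip_combination_left ip_combination_right combination_in)

text \<open>
  The right-hand side depends on the vectors only through their Gram matrix.  Hence the distance
  is the same in any two spaces in which \<open>y\<close> and the \<open>x i\<close> have the same inner products.
\<close>
lemma nrm_orthogonal_residual:
  assumes "finite I" "\<And>i. i \<in> I \<Longrightarrow> x i \<in> S" "y \<in> S"
    and orth: "\<And>k. k \<in> I \<Longrightarrow> ip (\<lambda>t. y t - (\<Sum>i\<in>I. c i * x i t)) (x k) = 0"
  shows "nrm (\<lambda>t. y t - (\<Sum>i\<in>I. c i * x i t)) = sqrt (Re (ip y y - (\<Sum>i\<in>I. c i * ip (x i) y)))"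
proof -
  let ?r = "\<lambda>t. y t - (\<Sum>i\<in>I. c i * x i t)"
  have v: "(\<lambda>t. \<Sum>i\<in>I. c i * x i t) \<in> S" using assms by (intro combination_in)
  then have r: "?r \<in> S" using assms by (intro diff_in)
  have "ip ?r ?r = ip ?r y - ip ?r (\<lambda>t. \<Sum>i\<in>I. c i * x i t)"
    by (rule ip_diff_right[OF assms(3) v r])
  also have "ip ?r (\<lambda>t. \<Sum>i\<in>I. c i * x i t) = 0"
    by (simp add: ip_combination_right assms(1,2) r orth)
  also have "ip ?r y = ip y y - (\<Sum>i\<in>I. c i * ip (x i) y)"
    using assms v by (simp add: ip_diff_left ip_combination_left)
  finally show ?thesis by (simp add: nrm_def)
qed

end

sublocale hilbert_function_space \<subseteq> semi_inner_function_space H ip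
  by unfold_locales
    (auto intro: zero_mem add_mem scale_mem ip_add ip_scale ip_commute ip_nonneg)

text \<open>
  The reproducing kernel space of the Gram kernel of a family \<open>x\<close> consists of the functions
  \<open>i \<mapsto> \<langle>z, x i\<rangle>\<close>, where \<open>z\<close> ranges over the closed span of the family and the inner product is
  that of the representing vectors.  The closed span is encoded as the double orthogonal complement
  \<open>V\<close>: this makes it closed under limits by continuity of the inner product, and it makes the
  representing vector unique up to norm \<open>0\<close>, because a member of \<open>V\<close> that is orthogonal to all
  \<open>x i\<close> is orthogonal to itself.
\<close>
theorem (in semi_inner_function_space) rkhs_exists:
  fixes x :: "'i \<Rightarrow> 't \<Rightarrow> complex"
  assumes x: "\<And>i. x i \<in> S"
    and complete: "\<And>u. \<lbrakk>\<And>k. u k \<in> S;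
        \<And>e. e > 0 \<Longrightarrow> \<exists>N. \<forall>k\<ge>N. \<forall>l\<ge>N. nrm (\<lambda>t. u k t - u l t) < e\<rbrakk>
       \<Longrightarrow> \<exists>f\<in>S. (\<lambda>k. nrm (\<lambda>t. u k t - f t)) \<longlonglongrightarrow> 0"
  shows "\<exists>H ip'. reproducing_kernel_hilbert_space (\<lambda>s t. ip (x s) (x t)) H ip'"
proof -
  define V where "V = {z \<in> S. \<forall>w\<in>S. (\<forall>i. ip w (x i) = 0) \<longrightarrow> ip z w = 0}"
  define F where "F z = (\<lambda>i. ip z (x i))" for z
  define Z where "Z f = (SOME z. z \<in> V \<and> F z = f)" for f
  define ip' where "ip' f g = ip (Z f) (Z g)" for f g
  have VS: "z \<in> V \<Longrightarrow> z \<in> S" for z by (simp add: V_def)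
  have V0: "(\<lambda>_. 0) \<in> V"
    using ip_scale_left[OF zero_in, of _ 0] by (auto simp: V_def zero_in)
  have Vadd: "(\<lambda>t. z t + w t) \<in> V" if "z \<in> V" "w \<in> V" for z w
    using that by (auto simp: V_def add_in ip_add_left)
  have Vscale: "(\<lambda>t. a * z t) \<in> V" if "z \<in> V" for z a
    using that by (auto simp: V_def scale_in ip_scale_left)
  have Vdiff: "(\<lambda>t. z t - w t) \<in> V" if "z \<in> V" "w \<in> V" for z w
    using that by (auto simp: V_def diff_in ip_diff_left)
  have Vx: "x i \<in> V" for i
    unfolding V_def
  proof (intro CollectI conjI ballI impI x)
    fix w assume "w \<in> S" "\<forall>j. ip w (x j) = 0"
    then show "ip (x i) w = 0" using ip_cnj[of w "x i"] x[of i] by simp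
  qed
  have Z: "Z f \<in> V \<and> F (Z f) = f" if "f \<in> F ` V" for f
    using someI_ex[of "\<lambda>z. z \<in> V \<and> F z = f"] that unfolding Z_def by blast
  have inj: "ip z w = ip z' w" if "z \<in> V" "z' \<in> V" "F z = F z'" "w \<in> S" for z z' w
  proof -
    let ?d = "\<lambda>t. z t - z' t"
    have d: "?d \<in> V" using that by (simp add: Vdiff)
    have "\<forall>i. ip ?d (x i) = 0"
      using that(3) by (auto simp: F_def fun_eq_iff ip_diff_left VS that x)
    then have "ip ?d ?d = 0" using d by (simp add: V_def)
    then have "ip ?d w = 0"
      using ip_eq_0_if_nrm_0[OF VS[OF d] that(4)] nrm_0_iff[OF VS[OF d]] by simp
    then show ?thesis by (simp add: ip_diff_left VS that)
  qed
  have ip'_F: "ip' (F z) (F w) = ip z w" if "z \<in> V" "w \<in> V" for z w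
  proof -
    have Zz: "Z (F z) \<in> V" "F (Z (F z)) = F z" and Zw: "Z (F w) \<in> V" "F (Z (F w)) = F w"
      using Z that by auto
    have "ip' (F z) (F w) = ip z (Z (F w))"
      unfolding ip'_def by (rule inj) (use Zz Zw that VS in auto)
    also have "\<dots> = cnj (ip (Z (F w)) z)" by (rule ip_cnj) (use Zw that VS in auto)
    also have "ip (Z (F w)) z = ip w z" by (rule inj) (use Zw that VS in auto)
    also have "cnj (ip w z) = ip z w" by (rule ip_cnj[symmetric]) (use that VS in auto)
    finally show ?thesis .
  qed
  have F0: "(\<lambda>_. 0) = F (\<lambda>_. 0)"
    using ip_scale_left[OF zero_in x, of 0] by (simp add: F_def)
  have Fadd: "(\<lambda>i. F z i + F w i) = F (\<lambda>t. z t + w t)" if "z \<in> V" "w \<in> V" for z w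
    using that by (simp add: F_def ip_add_left VS x)
  have Fdiff: "(\<lambda>i. F z i - F w i) = F (\<lambda>t. z t - w t)" if "z \<in> V" "w \<in> V" for z w
    using that by (simp add: F_def ip_diff_left VS x)
  have Fscale: "(\<lambda>i. a * F z i) = F (\<lambda>t. a * z t)" if "z \<in> V" for z a
    using that by (simp add: F_def ip_scale_left VS x)
  have "reproducing_kernel_hilbert_space (\<lambda>s t. ip (x s) (x t)) (F ` V) ip'"
  proof unfold_locales
    show "(\<lambda>_. 0) \<in> F ` V" using F0 V0 by blast
  next
    fix f assume "f \<in> F ` V" and *: "ip' f f = 0"
    then obtain z where z: "z \<in> V" "f = F z" by blast
    with * have "ip z z = 0" by (simp add: ip'_F)
    then have "nrm z = 0" by (simp add: nrm_0_iff VS z)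
    then show "f = (\<lambda>_. 0)"
      using ip_eq_0_if_nrm_0[OF VS[OF z(1)] x] z by (simp add: F_def)
  next
    fix u assume u: "\<And>k::nat. u k \<in> F ` V"
      and Cauchy: "\<And>e. 0 < e \<Longrightarrow> \<exists>N. \<forall>k\<ge>N. \<forall>l\<ge>N.
            sqrt (Re (ip' (\<lambda>t. u k t - u l t) (\<lambda>t. u k t - u l t))) < e"
    define z where "z k = Z (u k)" for k
    have z: "z k \<in> V" "u k = F (z k)" for k
      using Z[OF u[of k]] by (simp_all add: z_def)
    have nrm_F: "sqrt (Re (ip' (\<lambda>t. F v t - F w t) (\<lambda>t. F v t - F w t))) = nrm (\<lambda>t. v t - w t)"
      if "v \<in> V" "w \<in> V" for v w
      using that by (simp add: Fdiff ip'_F Vdiff nrm_def)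
    have "\<exists>f\<in>S. (\<lambda>k. nrm (\<lambda>t. z k t - f t)) \<longlonglongrightarrow> 0"
      by (rule complete) (use Cauchy z in \<open>simp_all add: VS nrm_F\<close>)
    then obtain f where f: "f \<in> S" and lim: "(\<lambda>k. nrm (\<lambda>t. z k t - f t)) \<longlonglongrightarrow> 0" by blast
    have "f \<in> V"
      unfolding V_def
    proof (intro CollectI conjI ballI impI f)
      fix w assume w: "w \<in> S" "\<forall>i. ip w (x i) = 0"
      have "norm (ip f w) \<le> nrm (\<lambda>t. z k t - f t) * nrm w" for k
      proof -
        have "ip (\<lambda>t. z k t - f t) w = - ip f w"
          using z(1)[of k] w by (simp add: ip_diff_left f V_def)
        then show ?thesis
          using Cauchy_Schwarz[OF diff_in[OF VS[OF z(1)] f] w(1), of k] by simp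
      qed
      moreover have "(\<lambda>k. nrm (\<lambda>t. z k t - f t) * nrm w) \<longlonglongrightarrow> 0"
        using tendsto_mult_right[OF lim, of "nrm w"] by simp
      ultimately have "norm (ip f w) \<le> 0"
        by (intro LIMSEQ_le_const) auto
      then show "ip f w = 0" by simp
    qed
    then show "\<exists>f\<in>F ` V. (\<lambda>k. sqrt (Re (ip' (\<lambda>t. u k t - f t) (\<lambda>t. u k t - f t)))) \<longlonglongrightarrow> 0"
      using lim z by (intro bexI[of _ "F f"]) (auto simp: nrm_F)
  next
    fix s show "(\<lambda>t. ip (x s) (x t)) \<in> F ` V"
      using Vx[of s] by (auto simp: F_def)
  next
    fix f s assume "f \<in> F ` V"
    then obtain z where z: "z \<in> V" "f = F z" by blast
    have "ip' (F z) (F (x s)) = ip z (x s)" using z Vx by (simp add: ip'_F)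
    then show "f s = ip' f (\<lambda>t. ip (x s) (x t))" by (simp add: z(2) F_def)
  next
    fix f g assume "f \<in> F ` V" "g \<in> F ` V"
    then show "ip' g f = cnj (ip' f g)"
      by (auto simp: ip'_F intro!: ip_cnj VS)
  qed (auto simp: ip'_F Fadd Fscale Vadd Vscale ip_add_left ip_scale_left VS ip_self_nonneg)
  then show ?thesis by blast
qed

section \<open>The space of square integrable functions\<close>

definition L2_inner :: "'a measure \<Rightarrow> ('a \<Rightarrow> complex) \<Rightarrow> ('a \<Rightarrow> complex) \<Rightarrow> complex" where
  "L2_inner M f g = (\<integral>x. f x * cnj (g x) \<partial>M)"

lemma integrable_mult_cnj:
  assumes "square_integrable M f" "square_integrable M g"
  shows "integrable M (\<lambda>x. f x * cnj (g x))"
proof (rule Bochner_Integration.integrable_bound)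
  show "integrable M (\<lambda>x. (norm (f x))\<^sup>2 + (norm (g x))\<^sup>2)"
    using assms by (simp add: square_integrable_def)
  have [measurable]: "f \<in> borel_measurable M" "g \<in> borel_measurable M"
    using assms by (simp_all add: square_integrable_def)
  show "(\<lambda>x. f x * cnj (g x)) \<in> borel_measurable M"
    by (intro borel_measurable_times borel_measurable_continuous_on[where f = cnj])
      (auto intro: continuous_intros)
  have "p * q \<le> p\<^sup>2 + q\<^sup>2" if "0 \<le> p" "0 \<le> q" for p q :: real
    using that sum_squares_bound[of p q] mult_nonneg_nonneg[OF that] by linarith
  then show "AE x in M. norm (f x * cnj (g x)) \<le> norm ((norm (f x))\<^sup>2 + (norm (g x))\<^sup>2)"
    by (intro AE_I2) (simp add: norm_mult)
qed

lemma square_integrable_add: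
  assumes "square_integrable M f" "square_integrable M g"
  shows "square_integrable M (\<lambda>x. f x + g x)"
  unfolding square_integrable_def
proof
  have [measurable]: "f \<in> borel_measurable M" "g \<in> borel_measurable M"
    using assms by (simp_all add: square_integrable_def)
  show "(\<lambda>x. f x + g x) \<in> borel_measurable M" by measurable
  show "integrable M (\<lambda>x. (norm (f x + g x))\<^sup>2)"
  proof (rule Bochner_Integration.integrable_bound)
    show "integrable M (\<lambda>x. 2 * (norm (f x))\<^sup>2 + 2 * (norm (g x))\<^sup>2)"
      using assms by (simp add: square_integrable_def)
    have "(norm (f x + g x))\<^sup>2 \<le> 2 * (norm (f x))\<^sup>2 + 2 * (norm (g x))\<^sup>2" for x
    proof -
      have "(norm (f x + g x))\<^sup>2 \<le> (norm (f x) + norm (g x))\<^sup>2"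
        by (simp add: norm_triangle_ineq power_mono)
      also have "\<dots> \<le> 2 * (norm (f x))\<^sup>2 + 2 * (norm (g x))\<^sup>2"
        using sum_squares_bound[of "norm (f x)" "norm (g x)"] by (simp add: power2_sum)
      finally show ?thesis .
    qed
    then show "AE x in M. norm ((norm (f x + g x))\<^sup>2) \<le> norm (2 * (norm (f x))\<^sup>2 + 2 * (norm (g x))\<^sup>2)"
      by (intro AE_I2) simp
  qed measurable
qed

lemma square_integrable_scale:
  "square_integrable M f \<Longrightarrow> square_integrable M (\<lambda>x. a * f x)"
  by (auto simp: square_integrable_def norm_mult power_mult_distrib)

lemma L2_inner_self: "L2_inner M f f = complex_of_real (\<integral>x. (norm (f x))\<^sup>2 \<partial>M)"
  unfolding L2_inner_def integral_complex_of_real[symmetric] complex_norm_square ..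

interpretation L2: semi_inner_function_space "Collect (square_integrable M)" "L2_inner M"
  rewrites "semi_inner_function_space.nrm (L2_inner M) = L2_norm M"
  for M :: "'a measure"
proof -
  show *: "semi_inner_function_space (Collect (square_integrable M)) (L2_inner M)"
  proof
    fix f g :: "'a \<Rightarrow> complex"
    show "L2_inner M g f = cnj (L2_inner M f g)"
      using Bochner_Integration.integral_cnj[of M "\<lambda>x. f x * cnj (g x)"]
      by (simp add: L2_inner_def mult.commute del: Bochner_Integration.integral_cnj)
  qed (auto simp: square_integrable_add square_integrable_scale L2_inner_self,
      auto simp: square_integrable_def L2_inner_def distrib_right mult.assoc
       integrable_mult_cnj[unfolded square_integrable_def])
  show "semi_inner_function_space.nrm (L2_inner M) = L2_norm M"
    by (rule ext) (simp add: semi_inner_function_space.nrm_def[OF *] L2_norm_def L2_inner_self)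
qed

lemma nn_integral_norm_square:
  "square_integrable M f \<Longrightarrow> (\<integral>\<^sup>+x. ennreal ((norm (f x))\<^sup>2) \<partial>M) = ennreal ((L2_norm M f)\<^sup>2)"
  by (simp add: square_integrable_def L2_norm_def nn_integral_eq_integral)

lemma square_integrable_if_nn_integral_le:
  assumes "f \<in> borel_measurable M" "(\<integral>\<^sup>+x. ennreal ((norm (f x))\<^sup>2) \<partial>M) \<le> ennreal (e\<^sup>2)" "0 \<le> e"
  shows "square_integrable M f" "L2_norm M f \<le> e"
proof -
  show *: "square_integrable M f"
    unfolding square_integrable_def
    using assms(1,2) by (auto intro!: integrableI_bounded order.strict_trans1[OF assms(2)])
  have "(L2_norm M f)\<^sup>2 \<le> e\<^sup>2"
    using assms(2) by (simp add: nn_integral_norm_square[OF *])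
  then show "L2_norm M f \<le> e"
    using assms(3) by (rule power2_le_imp_le)
qed

text \<open>
  Riesz-Fischer.  Along a subsequence with \<open>\<parallel>u (r (m+1)) - u (r m)\<parallel> \<le> 2\<^sup>-\<^sup>m\<close> the differences are
  almost everywhere summable, which gives a pointwise limit; Fatou's lemma turns the Cauchy
  condition into convergence to this limit in the norm.
\<close>
theorem L2_complete:
  fixes u :: "nat \<Rightarrow> 'a \<Rightarrow> complex"
  assumes u: "\<And>k. square_integrable M (u k)"
    and Cauchy: "\<And>e. e > 0 \<Longrightarrow> \<exists>N. \<forall>k\<ge>N. \<forall>l\<ge>N. L2_norm M (\<lambda>x. u k x - u l x) < e"
  shows "\<exists>f. square_integrable M f \<and> (\<lambda>k. L2_norm M (\<lambda>x. u k x - f x)) \<longlonglongrightarrow> 0"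
proof -
  have [measurable]: "u k \<in> borel_measurable M" for k
    using u by (simp add: square_integrable_def)
  have diff: "square_integrable M (\<lambda>x. f x - g x)"
    if "square_integrable M f" "square_integrable M g" for f g
    using L2.diff_in[of f M g] that by simp
  have nn_diff: "(\<integral>\<^sup>+x. ennreal ((norm (u k x - u l x))\<^sup>2) \<partial>M) \<le> ennreal (e\<^sup>2)"
    if "L2_norm M (\<lambda>x. u k x - u l x) < e" for k l e
  proof -
    have "0 \<le> L2_norm M (\<lambda>x. u k x - u l x)" by (simp add: L2_norm_def)
    then show ?thesis
      using that by (simp add: nn_integral_norm_square[OF diff[OF u u]] power_mono)
  qed
  have "\<forall>m. \<exists>N. \<forall>k\<ge>N. \<forall>l\<ge>N. L2_norm M (\<lambda>x. u k x - u l x) < (1/2) ^ m"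
    by (intro allI Cauchy) simp
  then obtain N where N: "\<And>m k l. N m \<le> k \<Longrightarrow> N m \<le> l \<Longrightarrow> L2_norm M (\<lambda>x. u k x - u l x) < (1/2) ^ m"
    by metis
  \<comment> \<open>Partial sums make \<open>r\<close> increasing with \<open>N m \<le> r m\<close>; the added \<open>m\<close> makes it unbounded.\<close>
  define r where "r m = (\<Sum>i\<le>m. N i) + m" for m
  have r_ge: "N m \<le> r m" "r m \<le> r (Suc m)" "m \<le> r m" for m
    by (auto simp: r_def intro: order.trans[OF member_le_sum[of m "{..m}" N]])
  define d where "d m x = norm (u (r (Suc m)) x - u (r m) x)" for m x
  \<comment> \<open>The weights \<open>2 ^ m\<close> keep the sum of the squares integrable and, since \<open>2 d \<le> 2 ^ m d\<^sup>2 + (1/2) ^ m\<close>, make \<open>d\<close> itself summable.\<close>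
  have "AE x in M. summable (\<lambda>m. d m x)"
  proof -
    have "(\<integral>\<^sup>+x. (\<Sum>m. ennreal (2 ^ m * (d m x)\<^sup>2)) \<partial>M) = (\<Sum>m. \<integral>\<^sup>+x. ennreal (2 ^ m * (d m x)\<^sup>2) \<partial>M)"
      unfolding d_def by (rule nn_integral_suminf) measurable
    also have "\<dots> \<le> (\<Sum>m. ennreal ((1/2) ^ m))"
    proof (intro suminf_le)
      fix m
      have "(\<integral>\<^sup>+x. ennreal (2 ^ m * (d m x)\<^sup>2) \<partial>M) = ennreal (2 ^ m) * (\<integral>\<^sup>+x. ennreal ((d m x)\<^sup>2) \<partial>M)"
        unfolding d_def by (subst nn_integral_cmult[symmetric]) (auto simp: ennreal_mult)
      also have "\<dots> \<le> ennreal (2 ^ m) * ennreal (((1/2) ^ m)\<^sup>2)"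
        unfolding d_def
        by (intro mult_left_mono nn_diff N) (auto intro: order.trans[OF r_ge(1) r_ge(2)] r_ge)
      also have "\<dots> = ennreal ((1/2) ^ m)"
        by (simp add: ennreal_mult[symmetric] power2_eq_square power_one_over)
      finally show "(\<integral>\<^sup>+x. ennreal (2 ^ m * (d m x)\<^sup>2) \<partial>M) \<le> ennreal ((1/2) ^ m)" .
    qed auto
    also have "\<dots> < \<infinity>"
      by (simp add: suminf_ennreal_eq[OF _ geometric_sums])
    finally have "AE x in M. (\<Sum>m. ennreal (2 ^ m * (d m x)\<^sup>2)) \<noteq> \<infinity>"
      unfolding d_def by (intro nn_integral_PInf_AE) auto
    then show ?thesis
    proof eventually_elim
      fix x assume "(\<Sum>m. ennreal (2 ^ m * (d m x)\<^sup>2)) \<noteq> \<infinity>"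
      then have "summable (\<lambda>m. 2 ^ m * (d m x)\<^sup>2)"
        by (intro summable_suminf_not_top) auto
      then have sm: "summable (\<lambda>m. 2 ^ m * (d m x)\<^sup>2 + (1/2) ^ m)"
        by (intro summable_add summable_geometric) auto
      show "summable (\<lambda>m. d m x)"
      proof (rule summable_comparison_test'[OF sm, of 0])
        fix m
        have "0 \<le> 2 ^ m * (d m x - (1/2) ^ m)\<^sup>2" by simp
        also have "\<dots> = 2 ^ m * (d m x)\<^sup>2 + (1/2) ^ m - 2 * d m x"
          by (simp add: power2_eq_square field_simps power_one_over)
        finally show "norm (d m x) \<le> 2 ^ m * (d m x)\<^sup>2 + (1/2) ^ m"
          by (simp add: d_def) (use norm_ge_zero[of "u (r (Suc m)) x - u (r m) x"] in linarith)
      qed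
    qed
  qed
  then have conv: "AE x in M. convergent (\<lambda>m. u (r m) x)"
  proof eventually_elim
    fix x assume "summable (\<lambda>m. d m x)"
    then have "summable (\<lambda>m. u (r (Suc m)) x - u (r m) x)"
      unfolding d_def by (rule summable_norm_cancel)
    then have "convergent (\<lambda>m. \<Sum>i<m. u (r (Suc i)) x - u (r i) x)"
      by (simp add: summable_iff_convergent)
    then have "convergent (\<lambda>m. u (r m) x - u (r 0) x)"
      by (subst (asm) sum_lessThan_telescope)
    from convergent_add[OF this convergent_const[of "u (r 0) x"]]
    show "convergent (\<lambda>m. u (r m) x)" by simp
  qed
  define f where "f x = lim (\<lambda>m. u (r m) x)" for x
  have [measurable]: "f \<in> borel_measurable M"
    unfolding f_def by measurable
  have tail: "square_integrable M (\<lambda>x. u k x - f x) \<and> L2_norm M (\<lambda>x. u k x - f x) \<le> e"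
    if "e > 0" and K: "\<And>l. l \<ge> K \<Longrightarrow> L2_norm M (\<lambda>x. u k x - u l x) < e" for e k K
  proof -
    have "(\<integral>\<^sup>+x. ennreal ((norm (u k x - f x))\<^sup>2) \<partial>M)
        = (\<integral>\<^sup>+x. liminf (\<lambda>m. ennreal ((norm (u k x - u (r m) x))\<^sup>2)) \<partial>M)"
    proof (rule nn_integral_cong_AE, use conv in eventually_elim)
      fix x assume "convergent (\<lambda>m. u (r m) x)"
      then have "(\<lambda>m. u (r m) x) \<longlonglongrightarrow> f x"
        unfolding f_def by (simp add: convergent_LIMSEQ_iff)
      then have "(\<lambda>m. ennreal ((norm (u k x - u (r m) x))\<^sup>2)) \<longlonglongrightarrow> ennreal ((norm (u k x - f x))\<^sup>2)"
        by (intro tendsto_intros)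
      then show "ennreal ((norm (u k x - f x))\<^sup>2) = liminf (\<lambda>m. ennreal ((norm (u k x - u (r m) x))\<^sup>2))"
        by (intro lim_imp_Liminf[symmetric]) simp_all
    qed
    also have "\<dots> \<le> liminf (\<lambda>m. \<integral>\<^sup>+x. ennreal ((norm (u k x - u (r m) x))\<^sup>2) \<partial>M)"
      by (rule nn_integral_liminf) measurable
    also have "\<dots> \<le> ennreal (e\<^sup>2)"
    proof -
      have "\<forall>\<^sub>F m in sequentially. (\<integral>\<^sup>+x. ennreal ((norm (u k x - u (r m) x))\<^sup>2) \<partial>M) \<le> ennreal (e\<^sup>2)"
        using eventually_ge_at_top[of K]
      proof eventually_elim
        fix m assume "K \<le> m"
        then show "(\<integral>\<^sup>+x. ennreal ((norm (u k x - u (r m) x))\<^sup>2) \<partial>M) \<le> ennreal (e\<^sup>2)"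
          by (intro nn_diff K) (rule order.trans[OF _ r_ge(3)])
      qed
      then have "liminf (\<lambda>m. \<integral>\<^sup>+x. ennreal ((norm (u k x - u (r m) x))\<^sup>2) \<partial>M) \<le> liminf (\<lambda>m::nat. ennreal (e\<^sup>2))"
        by (rule Liminf_mono)
      then show ?thesis by (simp add: Liminf_const)
    qed
    finally show ?thesis
      using \<open>e > 0\<close> by (auto intro!: square_integrable_if_nn_integral_le)
  qed
  have "square_integrable M f"
  proof -
    obtain K where "\<And>k l. k \<ge> K \<Longrightarrow> l \<ge> K \<Longrightarrow> L2_norm M (\<lambda>x. u k x - u l x) < 1"
      using Cauchy[of 1] by auto
    then have "square_integrable M (\<lambda>x. u K x - f x)" using tail[of 1 K K] by auto
    from diff[OF u[of K] this] show ?thesis by simp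
  qed
  moreover have "(\<lambda>k. L2_norm M (\<lambda>x. u k x - f x)) \<longlonglongrightarrow> 0"
  proof (rule LIMSEQ_I)
    fix e :: real assume "e > 0"
    then obtain K where K: "\<And>k l. k \<ge> K \<Longrightarrow> l \<ge> K \<Longrightarrow> L2_norm M (\<lambda>x. u k x - u l x) < e/2"
      using Cauchy[of "e/2"] by auto
    have "norm (L2_norm M (\<lambda>x. u k x - f x) - 0) < e" if "k \<ge> K" for k
      using tail[of "e/2" K k] K[OF that] \<open>e > 0\<close> by (simp add: L2_norm_def)
    then show "\<exists>K. \<forall>k\<ge>K. norm (L2_norm M (\<lambda>x. u k x - f x) - 0) < e" by blast
  qed
  ultimately show ?thesis by blast
qed

text \<open>
  The kernel is the Gram kernel of the family \<open>X\<close> in the complete space \<open>L\<^sup>2\<close>, so a reproducing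
  kernel space exists and the choice operator picks one.
\<close>
lemma L2_rkhs:
  assumes "\<And>t. square_integrable M (X t)"
  shows "reproducing_kernel_hilbert_space (autocorrelation M X)
    (fst (rkhs (autocorrelation M X))) (snd (rkhs (autocorrelation M X)))"
proof -
  have K: "autocorrelation M X = (\<lambda>s t. L2_inner M (X s) (X t))"
    by (simp add: autocorrelation_def L2_inner_def fun_eq_iff)
  obtain H ip where H: "reproducing_kernel_hilbert_space (autocorrelation M X) H ip"
    unfolding K
    using L2.rkhs_exists[of X M] assms L2_complete[of M] by auto
  have "case rkhs (autocorrelation M X) of (H, ip) \<Rightarrow>
      reproducing_kernel_hilbert_space (autocorrelation M X) H ip"
    unfolding rkhs_def by (rule someI[of _ "(H, ip)"]) (simp add: H)
  then show ?thesis by (simp add: case_prod_beta)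
qed

section \<open>Linear recurrences and square integrable functions\<close>

text \<open>
  The mass of \<open>g\<close> on a half-line \<open>[a,\<infinity>)\<close> does not exceed its mass on \<open>[a + k,\<infinity>)\<close>, which tends
  to \<open>0\<close> as \<open>k\<close> grows.
\<close>
lemma integrable_step_increasing_zero:
  fixes g :: "real \<Rightarrow> real"
  assumes cont: "continuous_on UNIV g" and int: "integrable lborel g"
    and nonneg: "\<And>t. 0 \<le> g t" and step: "\<And>t. g t \<le> g (t + 1)"
  shows "g t = 0"
proof -
  define a where "a = t - 1"
  define H where "H k = (\<integral>x. indicator {a + real k..} x * g x \<partial>lborel)" for k
  have int_ind: "integrable lborel (\<lambda>x. indicator {b..} x * g x)" for b :: real
    using integrable_mult_indicator[OF _ int, of "{b..}"] by simp
  have step': "g x \<le> g (x + real k)" for x k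
  proof (induction k)
    case (Suc k)
    then show ?case using step[of "x + real k"] by (simp add: algebra_simps)
  qed simp
  have "H 0 \<le> H k" for k
  proof -
    have "H 0 = (\<integral>x. indicator {a..} x * g x \<partial>lborel)" by (simp add: H_def)
    also have "\<dots> \<le> (\<integral>x. indicator {a + real k..} (real k + 1 * x) * g (real k + 1 * x) \<partial>lborel)"
    proof (rule integral_mono[OF int_ind])
      show "integrable lborel (\<lambda>x. indicator {a + real k..} (real k + 1 * x) * g (real k + 1 * x))"
        using lborel_integrable_real_affine[OF int_ind, of 1 "a + real k" "real k"] by simp
      show "indicator {a..} x * g x \<le> indicator {a + real k..} (real k + 1 * x) * g (real k + 1 * x)" for x
        using step'[of x k] nonneg by (auto simp: indicator_def add.commute)
    qed
    also have "\<dots> = H k"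
      unfolding H_def using lborel_integral_real_affine[of 1 "\<lambda>x. indicator {a + real k..} x * g x" "real k"]
      by simp
    finally show ?thesis .
  qed
  moreover have "H \<longlonglongrightarrow> (\<integral>x. 0 \<partial>(lborel :: real measure))"
    unfolding H_def
  proof (rule integral_dominated_convergence[OF _ _ int])
    show "AE x in lborel. (\<lambda>k. indicator {a + real k..} x * g x) \<longlonglongrightarrow> 0"
    proof (rule AE_I2)
      fix x
      obtain m where "x - a < real m" using reals_Archimedean2 by blast
      then have "\<forall>\<^sub>F k in sequentially. indicator {a + real k..} x * g x = 0"
        by (intro eventually_sequentiallyI[of m]) (auto simp: indicator_def)
      then show "(\<lambda>k. indicator {a + real k..} x * g x) \<longlonglongrightarrow> 0"
        by (rule tendsto_eventually)
    qed
    show "AE x in lborel. norm (indicator {a + real k..} x * g x) \<le> g x" for k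
      using nonneg by (intro AE_I2) (auto simp: indicator_def)
  qed (use int_ind in auto)
  ultimately have "H 0 \<le> 0"
    by (intro LIMSEQ_le_const[of H 0 "H 0"]) auto
  then have "H 0 = 0"
    unfolding H_def by (intro antisym) (auto intro!: integral_nonneg simp: nonneg)
  then have "AE x in lborel. indicator {a..} x * g x = 0"
    using integral_nonneg_eq_0_iff_AE[OF int_ind] nonneg by (simp add: H_def)
  then have "AE x in lebesgue. x \<in> {a<..} \<longrightarrow> x \<in> {x. g x = 0}"
    by (intro AE_completion) (auto elim!: eventually_mono simp: indicator_def split: if_splits)
  moreover have "closed {x. g x = 0}"
    using cont by (intro closed_Collect_eq) auto
  moreover have "t \<in> {a<..}" by (simp add: a_def)
  ultimately have "t \<in> {x. g x = 0}"
    using mem_closed_if_AE_lebesgue_open[OF open_greaterThan] by blast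
  then show ?thesis by simp
qed

lemma square_integrable_shift:
  assumes "square_integrable lborel f"
  shows "square_integrable lborel (\<lambda>t. f (t + (c::real)))"
proof -
  have "f \<in> borel_measurable borel" "integrable lborel (\<lambda>t. (norm (f t))\<^sup>2)"
    using assms by (auto simp: square_integrable_def)
  then show ?thesis
    using lborel_integrable_real_affine[of "\<lambda>t. (norm (f t))\<^sup>2" 1 c]
    by (auto simp: square_integrable_def add.commute)
qed

text \<open>
  The modulus of \<open>f\<close> does not decrease under unit steps to the right if \<open>\<bar>c\<bar> \<ge> 1\<close>, and under unit
  steps to the left if \<open>\<bar>c\<bar> \<le> 1\<close>.
\<close>
lemma square_integrable_multiplicative_zero:
  fixes f :: "real \<Rightarrow> complex"
  assumes cont: "continuous_on UNIV f" and sq: "square_integrable lborel f"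
    and shift: "\<And>t. f (t + 1) = c * f t"
  shows "f t = 0"
proof (cases "1 \<le> norm c")
  case True
  have "(norm (f t))\<^sup>2 = 0"
  proof (rule integrable_step_increasing_zero[of "\<lambda>t. (norm (f t))\<^sup>2"])
    show "(norm (f t))\<^sup>2 \<le> (norm (f (t + 1)))\<^sup>2" for t
      using mult_right_mono[OF True, of "norm (f t)"]
      by (intro power_mono) (simp_all add: shift norm_mult)
  qed (use sq in \<open>auto simp: square_integrable_def intro!: continuous_intros cont\<close>)
  then show ?thesis by simp
next
  case False
  have "(norm (f (- (- t))))\<^sup>2 = 0"
  proof (rule integrable_step_increasing_zero[of "\<lambda>t. (norm (f (- t)))\<^sup>2"])
    show "(norm (f (- t)))\<^sup>2 \<le> (norm (f (- (t + 1))))\<^sup>2" for t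
      using mult_right_mono[of "norm c" 1 "norm (f (- t - 1))"] False shift[of "- t - 1"]
      by (intro power_mono) (simp_all add: norm_mult)
    show "integrable lborel (\<lambda>t. (norm (f (- t)))\<^sup>2)"
      using lborel_integrable_real_affine[of "\<lambda>t. (norm (f t))\<^sup>2" "-1" 0] sq
      by (simp add: square_integrable_def)
    show "continuous_on UNIV (\<lambda>t. (norm (f (- t)))\<^sup>2)"
      by (intro continuous_intros continuous_on_compose2[OF cont]) auto
  qed simp
  then show ?thesis by simp
qed

text \<open>
  The hypothesis says that \<open>p\<close>, evaluated at the unit shift operator, annihilates \<open>f\<close>.  Over the
  complex numbers \<open>p\<close> splits into linear factors, and each factor \<open>shift - z\<close> is injective on
  continuous square integrable functions by the previous lemma.
\<close>
lemma square_integrable_recurrence_zero: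
  fixes f :: "real \<Rightarrow> complex" and p :: "complex Polynomial.poly"
  assumes "p \<noteq> 0" "Polynomial.degree p \<le> n"
    and "continuous_on UNIV f" "square_integrable lborel f"
    and "\<And>t. (\<Sum>i\<le>n. Polynomial.coeff p i * f (t + real i)) = 0"
  shows "f t = 0"
  using assms
proof (induction "Polynomial.degree p" arbitrary: p n f t)
  case 0
  then obtain c where p: "p = [:c:]" "c \<noteq> 0"
    using degree_eq_zeroE by (metis pCons_eq_0_iff)
  have "(\<Sum>i\<le>n. Polynomial.coeff p i * f (t + real i)) = (\<Sum>i\<in>{0}. Polynomial.coeff p i * f (t + real i))"
    by (rule sum.mono_neutral_right) (auto simp: p coeff_pCons split: nat.splits)
  then show ?case using 0(6)[of t] p by simp
next
  case (Suc d)
  have "\<not> constant (Polynomial.poly p)"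
    using Suc.hyps(2) by (simp add: constant_degree)
  then obtain z where "Polynomial.poly p z = 0"
    using fundamental_theorem_of_algebra by blast
  then obtain q where p: "p = [:- z, 1:] * q"
    by (auto simp: poly_eq_0_iff_dvd)
  have q: "q \<noteq> 0" using Suc.prems(1) p by auto
  have deg: "Polynomial.degree p = Suc (Polynomial.degree q)"
    unfolding p using q by (subst degree_mult_eq) auto
  obtain m where n: "n = Suc m" "Polynomial.degree q \<le> m"
    using Suc.prems(2) deg by (cases n) auto
  define g where "g t = f (t + 1) - z * f t" for t
  have "g t = 0" for t
  proof (rule Suc.hyps(1)[OF _ q n(2)])
    show "d = Polynomial.degree q" using Suc.hyps(2) deg by simp
    show "continuous_on UNIV g"
      unfolding g_def by (intro continuous_intros continuous_on_compose2[OF Suc.prems(3)]) auto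
    show "square_integrable lborel g"
      unfolding g_def
      using L2.diff_in[of "\<lambda>t. f (t + 1)" lborel "\<lambda>t. z * f t"] Suc.prems(4)
      by (simp add: square_integrable_shift square_integrable_scale)
    fix t
    have "(\<Sum>i\<le>n. Polynomial.coeff p i * f (t + real i)) =
        (\<Sum>i\<le>Suc m. Polynomial.coeff (pCons 0 q) i * f (t + real i)) - z * (\<Sum>i\<le>Suc m. Polynomial.coeff q i * f (t + real i))"
      by (simp add: p n(1) algebra_simps sum.distrib sum_subtractf sum_distrib_left del: sum.atMost_Suc)
    also have "(\<Sum>i\<le>Suc m. Polynomial.coeff (pCons 0 q) i * f (t + real i)) = (\<Sum>i\<le>m. Polynomial.coeff q i * f (t + 1 + real i))"
      by (simp add: sum.atMost_Suc_shift algebra_simps del: sum.atMost_Suc)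
    also have "(\<Sum>i\<le>Suc m. Polynomial.coeff q i * f (t + real i)) = (\<Sum>i\<le>m. Polynomial.coeff q i * f (t + real i))"
      using n(2) by (simp add: coeff_eq_0)
    finally show "(\<Sum>i\<le>m. Polynomial.coeff q i * g (t + real i)) = 0"
      using Suc.prems(5)[of t]
      by (simp add: g_def algebra_simps sum_subtractf sum_distrib_left)
  qed
  then have "f (t + 1) = z * f t" for t
    unfolding g_def by (metis eq_iff_diff_eq_0)
  then show ?case
    by (rule square_integrable_multiplicative_zero[OF Suc.prems(3,4)])
qed

section \<open>Linear independence of the integer samples\<close>

lemma autocorrelation_eq_L2_inner: "autocorrelation M X s t = L2_inner M (X s) (X t)"
  by (simp add: autocorrelation_def L2_inner_def)

lemma finite_J: "finite (J n)"
  by (simp add: J_def)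

lemma sum_J: "(\<Sum>j\<in>J n. f j) = (\<Sum>i<2 * n. f (J_elem n i))"
  by (rule sum.reindex_bij_betw[OF bij_betw_J_elem, symmetric])

lemma J_elem_in: "i < 2 * n \<Longrightarrow> J_elem n i \<in> J n"
  by (auto simp: J_def J_elem_def)

lemma J_elemE:
  assumes "j \<in> J n"
  obtains i where "i < 2 * n" "j = J_elem n i"
  using assms that[of "nat (j + int n - 1)"] by (auto simp: J_def J_elem_def)

text \<open>
  A vanishing combination of integer samples can be translated: by stationarity
  \<open>\<Sum> a\<^sub>j X(t + j)\<close> has norm \<open>0\<close> for every real \<open>t\<close>.  Its inner product with \<open>X(0)\<close> is a linear
  recurrence with constant coefficients for the autocorrelation function.
\<close>
lemma samples_independent:
  assumes wss: "wide_sense_stationary M X"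
    and cont: "continuous_on UNIV (\<lambda>t. autocorrelation M X t 0)"
    and sq: "square_integrable lborel (\<lambda>t. autocorrelation M X t 0)"
    and nontrivial: "\<exists>t. autocorrelation M X t 0 \<noteq> 0"
    and null: "L2_norm M (\<lambda>\<omega>. \<Sum>j\<in>J n. a j * X (of_int j) \<omega>) = 0"
    and j: "j \<in> J n"
  shows "a j = 0"
proof (rule ccontr)
  assume aj: "a j \<noteq> 0"
  have X: "square_integrable M (X t)" for t
    using wss by (simp add: wide_sense_stationary_def)
  have stat: "L2_inner M (X (t + s)) (X (t + u)) = L2_inner M (X s) (X u)" for s t u
    using wss unfolding wide_sense_stationary_def autocorrelation_eq_L2_inner
    by (metis add_diff_cancel_left)
  have rec_J: "(\<Sum>j\<in>J n. a j * autocorrelation M X (t + of_int j) 0) = 0" for t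
  proof -
    let ?Y = "\<lambda>s \<omega>. \<Sum>j\<in>J n. a j * X (s + of_int j) \<omega>"
    have Y: "?Y s \<in> Collect (square_integrable M)" for s
      by (rule L2.combination_in) (simp_all add: finite_J X)
    have "L2_inner M (?Y t) (?Y t) = L2_inner M (?Y 0) (?Y 0)"
      by (simp add: L2.ip_combinations finite_J X stat stat[of 0, simplified])
    then have "L2_norm M (?Y t) = 0"
      using null L2.nrm_0_iff[OF Y[of t]] L2.nrm_0_iff[OF Y[of 0]] by simp
    then have "L2_inner M (?Y t) (X 0) = 0"
      using Y[of t] X by (intro L2.ip_eq_0_if_nrm_0) simp_all
    then show ?thesis
      by (simp add: L2.ip_combination_left finite_J X autocorrelation_eq_L2_inner)
  qed
  \<comment> \<open>The index set starts at \<open>1 - n\<close>; the recurrence is moved to the exponents \<open>0,\<dots>,2n-1\<close> by translating \<open>t\<close>.\<close>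
  define p where "p = (\<Sum>i<2 * n. Polynomial.monom (a (J_elem n i)) i)"
  have coeff_p: "Polynomial.coeff p i = (if i < 2 * n then a (J_elem n i) else 0)" for i
    by (simp add: p_def coeff_sum)
  have "j = J_elem n (nat (j + int n - 1))" "nat (j + int n - 1) < 2 * n"
    using j by (auto simp: J_def J_elem_def)
  then have "p \<noteq> 0"
    using aj coeff_p by (metis coeff_0)
  moreover have "Polynomial.degree p \<le> 2 * n"
    by (rule degree_le) (simp add: coeff_p)
  moreover have "(\<Sum>i\<le>2 * n. Polynomial.coeff p i * autocorrelation M X (t + real i) 0) = 0" for t
  proof -
    have "(\<Sum>i\<le>2 * n. Polynomial.coeff p i * autocorrelation M X (t + real i) 0) =
        (\<Sum>i<2 * n. a (J_elem n i) * autocorrelation M X (t + real i) 0)"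
      by (rule sum.mono_neutral_cong_right) (auto simp: coeff_p)
    also have "\<dots> = (\<Sum>j\<in>J n. a j * autocorrelation M X ((t + real n - 1) + of_int j) 0)"
      by (simp add: sum_J J_elem_def)
    finally show ?thesis by (simp add: rec_J)
  qed
  ultimately have "autocorrelation M X t 0 = 0" for t
    by (rule square_integrable_recurrence_zero[OF _ _ cont sq])
  with nontrivial show False by blast
qed

section \<open>The kernel matrix and the normal equations\<close>

lemma kernel_matrix_carrier: "kernel_matrix n K \<in> carrier_mat (2 * n) (2 * n)"
  by (simp add: kernel_matrix_def)

text \<open>
  A vector \<open>v\<close> in the kernel of the Gram matrix gives the combination with the conjugate coefficients
  \<open>cnj v\<^sub>j\<close> norm \<open>0\<close>; the conjugates occur because the inner product is linear in its first
  argument.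
\<close>
lemma det_kernel_matrix_nonzero:
  assumes X: "\<And>t. square_integrable M (X t)"
    and indep: "\<And>a j. \<lbrakk>L2_norm M (\<lambda>\<omega>. \<Sum>j\<in>J n. a j * X (of_int j) \<omega>) = 0; j \<in> J n\<rbrakk> \<Longrightarrow> a j = 0"
  shows "Determinant.det (kernel_matrix n (autocorrelation M X)) \<noteq> 0"
proof
  let ?G = "kernel_matrix n (autocorrelation M X)"
  assume "Determinant.det ?G = 0"
  then obtain v where v: "v \<in> carrier_vec (2 * n)" "v \<noteq> 0\<^sub>v (2 * n)" "?G *\<^sub>v v = 0\<^sub>v (2 * n)"
    using det_0_iff_vec_prod_zero_field[OF kernel_matrix_carrier[of n "autocorrelation M X"]] by blast
  define a where "a j = cnj (vec_index v (nat (j + int n - 1)))" for j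
  have a: "a (J_elem n i) = cnj (vec_index v i)" for i
    by (simp add: a_def J_elem_def)
  have row: "(\<Sum>k\<in>J n. cnj (a k) * L2_inner M (X (of_int j)) (X (of_int k))) = 0" if j: "j \<in> J n" for j
  proof -
    obtain i where i: "i < 2 * n" "j = J_elem n i" using j by (rule J_elemE)
    have "vec_index (?G *\<^sub>v v) i = 0" using v(3) i by simp
    then have "(\<Sum>k<2 * n. autocorrelation M X (of_int j) (of_int (J_elem n k)) * vec_index v k) = 0"
      using i v(1) by (simp add: kernel_matrix_def scalar_prod_def atLeast0LessThan)
    then show ?thesis
      by (simp add: sum_J a autocorrelation_eq_L2_inner mult.commute)
  qed
  have "L2_inner M (\<lambda>\<omega>. \<Sum>j\<in>J n. a j * X (of_int j) \<omega>) (\<lambda>\<omega>. \<Sum>j\<in>J n. a j * X (of_int j) \<omega>) = 0"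
    by (simp add: L2.ip_combinations finite_J X row)
  moreover have "(\<lambda>\<omega>. \<Sum>j\<in>J n. a j * X (of_int j) \<omega>) \<in> Collect (square_integrable M)"
    by (rule L2.combination_in) (simp_all add: finite_J X)
  ultimately have "L2_norm M (\<lambda>\<omega>. \<Sum>j\<in>J n. a j * X (of_int j) \<omega>) = 0"
    by (simp add: L2.nrm_0_iff)
  then have "a (J_elem n i) = 0" if "i < 2 * n" for i
    using indep J_elem_in[OF that] by blast
  then have "v = 0\<^sub>v (2 * n)"
    using v(1) by (intro eq_vecI) (auto simp: a)
  with v(2) show False by simp
qed

lemma matrix_inverse:
  assumes A: "A \<in> carrier_mat m m" and det: "Determinant.det A \<noteq> 0"
  shows "A * matrix_inverse A = 1\<^sub>m m" "matrix_inverse A * A = 1\<^sub>m m"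
    "matrix_inverse A \<in> carrier_mat m m"
proof -
  obtain B where "mat_inverse A = Some B"
    using mat_inverse(1)[OF A] det_non_zero_imp_unit[OF A det] by fastforce
  then show "A * matrix_inverse A = 1\<^sub>m m" "matrix_inverse A * A = 1\<^sub>m m"
    "matrix_inverse A \<in> carrier_mat m m"
    using mat_inverse(2)[OF A] by (auto simp: matrix_inverse_def)
qed

lemma row_on_J_eq_iff: "row_on_J n v = row_on_J n w \<longleftrightarrow> (\<forall>j\<in>J n. v j = w j)"
proof
  assume eq: "row_on_J n v = row_on_J n w"
  show "\<forall>j\<in>J n. v j = w j"
  proof
    fix j assume "j \<in> J n"
    then obtain i where "i < 2 * n" "j = J_elem n i" by (rule J_elemE)
    then show "v j = w j"
      using arg_cong[OF eq, of "\<lambda>A. A $$ (0, i)"] by (simp add: row_on_J_def)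
  qed
qed (auto simp: row_on_J_def J_elem_in intro!: eq_matI)

lemma row_mult_kernel_matrix:
  "row_on_J n v * kernel_matrix n K = row_on_J n (\<lambda>k. \<Sum>j\<in>J n. v j * K (of_int j) (of_int k))"
  by (rule eq_matI)
    (auto simp: row_on_J_def kernel_matrix_def scalar_prod_def sum_J atLeast0LessThan)

lemma row_eq_mult_inverse_iff:
  assumes det: "Determinant.det (kernel_matrix n K) \<noteq> 0"
  shows "row_on_J n v = row_on_J n w * matrix_inverse (kernel_matrix n K) \<longleftrightarrow>
    (\<forall>k\<in>J n. (\<Sum>j\<in>J n. v j * K (of_int j) (of_int k)) = w k)"
proof -
  let ?G = "kernel_matrix n K"
  note inv = matrix_inverse[OF kernel_matrix_carrier det]
  have row: "row_on_J n u \<in> carrier_mat 1 (2 * n)" for u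
    by (simp add: row_on_J_def)
  have "row_on_J n v = row_on_J n w * matrix_inverse ?G \<longleftrightarrow> row_on_J n v * ?G = row_on_J n w"
  proof
    assume "row_on_J n v = row_on_J n w * matrix_inverse ?G"
    then show "row_on_J n v * ?G = row_on_J n w"
      using assoc_mult_mat[OF row inv(3) kernel_matrix_carrier] inv(2) right_mult_one_mat[OF row] by simp
  next
    assume "row_on_J n v * ?G = row_on_J n w"
    then show "row_on_J n v = row_on_J n w * matrix_inverse ?G"
      using assoc_mult_mat[OF row kernel_matrix_carrier inv(3)] inv(1) right_mult_one_mat[OF row] by metis
  qed
  then show ?thesis
    by (simp add: row_mult_kernel_matrix row_on_J_eq_iff)
qed

section \<open>The intrinsic error of a translation-invariant kernel\<close>

lemma (in reproducing_kernel_hilbert_space) kernel_ip: "ip (K s) (K t) = K s t"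
  using reproducing[OF kernel_mem] by simp

text \<open>
  By the reproducing property \<open>\<bar>f s - f t\<bar> \<le> \<parallel>f\<parallel> \<parallel>K s - K t\<parallel>\<close>, and for a translation-invariant
  kernel the last norm is determined by \<open>r (s - t)\<close>.
\<close>
lemma rkhs_member_continuous:
  fixes r :: "'t::real_normed_vector \<Rightarrow> complex"
  assumes rk: "reproducing_kernel_hilbert_space K H ip"
    and K: "\<And>s t. K s t = r (s - t)" and r: "continuous_on UNIV r" and f: "f \<in> H"
  shows "continuous_on UNIV f"
proof -
  interpret reproducing_kernel_hilbert_space K H ip by (rule rk)
  have bound: "norm (f s - f t) \<le> nrm f * sqrt (2 * Re (r 0) - 2 * Re (r (s - t)))" for s t
  proof -
    have "(nrm (\<lambda>x. K s x - K t x))\<^sup>2 = 2 * Re (r 0) - 2 * Re (r (s - t))"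
    proof -
      have "(nrm (K u))\<^sup>2 = Re (r 0)" for u
        using arg_cong[OF ip_self[OF kernel_mem[of u]], of Re] by (simp add: kernel_ip K)
      then show ?thesis
        using nrm_diff_sqr[OF kernel_mem kernel_mem, of s t] by (simp add: kernel_ip K[of s t])
    qed
    then have "nrm (\<lambda>x. K s x - K t x) = sqrt (2 * Re (r 0) - 2 * Re (r (s - t)))"
      by (metis diff_in kernel_mem nrm_nonneg real_sqrt_unique)
    moreover have "f s - f t = ip f (\<lambda>x. K s x - K t x)"
      by (simp add: ip_diff_right kernel_mem f reproducing[OF f])
    ultimately show ?thesis
      using Cauchy_Schwarz[OF f diff_in[OF kernel_mem kernel_mem], of s t] by simp
  qed
  have "isCont f t" for t
    unfolding isCont_def
  proof (rule LIM_zero_cancel, rule Lim_null_comparison)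
    show "\<forall>\<^sub>F s in at t. norm (f s - f t) \<le> nrm f * sqrt (2 * Re (r 0) - 2 * Re (r (s - t)))"
      using bound by simp
    have "isCont r (t - t)" using r by (simp add: continuous_on_eq_continuous_at)
    then have "isCont (\<lambda>s. r (s - t)) t"
      by (intro isCont_o2[of t "\<lambda>s. s - t" r]) (auto intro!: continuous_intros)
    then have "((\<lambda>s. r (s - t)) \<longlongrightarrow> r 0) (at t)" by (simp add: isCont_def)
    then have "((\<lambda>s. Re (r (s - t))) \<longlongrightarrow> Re (r 0)) (at t)" by (rule tendsto_Re)
    then have "((\<lambda>s. nrm f * sqrt (2 * Re (r 0) - 2 * Re (r (s - t)))) \<longlongrightarrow>
        nrm f * sqrt (2 * Re (r 0) - 2 * Re (r 0))) (at t)"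
      by (intro tendsto_mult tendsto_real_sqrt tendsto_diff tendsto_const)
    then show "((\<lambda>s. nrm f * sqrt (2 * Re (r 0) - 2 * Re (r (s - t)))) \<longlongrightarrow> 0) (at t)" by simp
  qed
  then show ?thesis by (simp add: continuous_on_eq_continuous_at)
qed

lemma AE_norm_le_Linf_norm: "AE t in lebesgue_on {0..1}. ennreal (norm (f t)) \<le> Linf_norm f"
  unfolding Linf_norm_def by (rule esssup_AE)

lemma continuous_measurable_unit_interval:
  "continuous_on UNIV f \<Longrightarrow> f \<in> borel_measurable (lebesgue_on {0..1::real})"
  by (rule continuous_imp_measurable_on_sets_lebesgue) (auto elim: continuous_on_subset)

lemma Linf_norm_le:
  assumes "f \<in> borel_measurable (lebesgue_on {0..1})"
    and "AE t in lebesgue_on {0..1}. ennreal (norm (f t)) \<le> C"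
  shows "Linf_norm f \<le> C"
  unfolding Linf_norm_def using assms by (intro esssup_I) auto

lemma AE_unit_interval_interior: "AE t in lebesgue_on {0..1::real}. t \<in> {0<..<1}"
proof -
  have "AE t in lborel. t \<noteq> (0::real)" "AE t in lborel. t \<noteq> (1::real)"
    by (rule AE_lborel_singleton)+
  then have "AE t in lborel. t \<in> {0..1::real} \<longrightarrow> t \<in> {0<..<1}"
    by eventually_elim auto
  then show ?thesis
    by (subst AE_restrict_space_iff) (auto intro: AE_completion)
qed

lemma continuous_le_if_AE:
  assumes cont: "continuous_on UNIV f" and AE: "AE t in lebesgue_on {0..1}. norm (f t) \<le> e"
    and t: "t \<in> {0<..<1::real}"
  shows "norm (f t) \<le> e"
proof -
  have "AE t in lebesgue. t \<in> {0..1} \<longrightarrow> norm (f t) \<le> e"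
    using AE by (subst (asm) AE_restrict_space_iff) auto
  then have "AE t in lebesgue. t \<in> {0<..<1} \<longrightarrow> t \<in> {t. norm (f t) \<le> e}"
    by eventually_elim auto
  moreover have "closed {t. norm (f t) \<le> e}"
    by (intro closed_Collect_le continuous_intros cont)
  ultimately have "t \<in> {t. norm (f t) \<le> e}"
    using mem_closed_if_AE_lebesgue_open[OF open_greaterThanLessThan _ _ t] by blast
  then show ?thesis by simp
qed

text \<open>
  A recovery map cannot tell \<open>f\<close> from \<open>-f\<close> when both have zero samples.  It returns the same function
  \<open>g\<close> for both, and one of the errors \<open>\<bar>f - g\<bar>\<close>, \<open>\<bar>-f - g\<bar>\<close> is at least \<open>\<bar>f\<bar>\<close>.
\<close>
lemma recovery_error_ge:
  assumes rk: "reproducing_kernel_hilbert_space K (fst (rkhs K)) (snd (rkhs K))"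
    and f: "f \<in> rkhs_unit_ball K" and cont: "continuous_on UNIV f"
    and zero: "\<And>j. j \<in> J n \<Longrightarrow> f (of_int j) = 0" and t: "t \<in> {0<..<1}"
  shows "ennreal (norm (f t)) \<le> recovery_error n A K"
proof (cases "recovery_error n A K")
  case (real e)
  interpret reproducing_kernel_hilbert_space K "fst (rkhs K)" "snd (rkhs K)" by (rule rk)
  define g where "g = A (restrict (\<lambda>j. 0) (J n))"
  have f_mem: "f \<in> fst (rkhs K)" and f_nrm: "nrm f \<le> 1"
    using f by (simp_all add: rkhs_unit_ball_def nrm_def)
  have close: "AE t in lebesgue_on {0..1}. norm (u t - g t) \<le> e"
    if u: "u \<in> rkhs_unit_ball K" and u0: "\<And>j. j \<in> J n \<Longrightarrow> u (of_int j) = 0" for u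
  proof -
    have samples: "restrict (\<lambda>j. 0) (J n) = restrict (\<lambda>j. u (of_int j)) (J n)"
      by (rule restrict_ext) (simp add: u0)
    have "Linf_norm (\<lambda>t. u t - g t) \<le> ennreal e"
      unfolding real(2)[symmetric] recovery_error_def g_def samples by (rule SUP_upper[OF u])
    then show ?thesis
      using AE_norm_le_Linf_norm[of "\<lambda>t. u t - g t"] real(1)
      by (auto elim!: eventually_mono dest: order.trans)
  qed
  have "(\<lambda>t. - f t) \<in> rkhs_unit_ball K"
    using scale_in[OF f_mem, of "-1"] nrm_scale[OF f_mem, of "-1"] f_nrm
    by (simp add: rkhs_unit_ball_def nrm_def)
  then have "AE t in lebesgue_on {0..1}. norm (- f t - g t) \<le> e"
    by (rule close) (simp add: zero)
  moreover have "AE t in lebesgue_on {0..1}. norm (f t - g t) \<le> e"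
    using f zero by (rule close)
  ultimately have "AE t in lebesgue_on {0..1}. norm (f t) \<le> e"
  proof eventually_elim
    fix t assume "norm (- f t - g t) \<le> e" "norm (f t - g t) \<le> e"
    moreover have "norm (2 * f t) \<le> norm (f t - g t) + norm (- f t - g t)"
      using norm_triangle_ineq4[of "f t - g t" "- f t - g t"] by simp
    ultimately show "norm (f t) \<le> e" by (simp add: norm_mult)
  qed
  then have "norm (f t) \<le> e"
    by (rule continuous_le_if_AE[OF cont _ t])
  then show ?thesis
    using real by simp
qed simp

text \<open>
  The residual \<open>h t\<close> of \<open>K t\<close> after projection onto the span of the \<open>K j\<close>, \<open>j \<in> J n\<close>, is
  orthogonal to the \<open>K j\<close> and therefore vanishes on \<open>J n\<close>.  Normalized, it is an admissible function
  for the lower bound of any recovery error, and its value at \<open>t\<close> is \<open>\<parallel>h t\<parallel>\<close>.  In the other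
  direction, the linear recovery map with the conjugate projection coefficients has the error
  \<open>\<langle>f, h t\<rangle>\<close> at \<open>t\<close>, which is at most \<open>\<parallel>h t\<parallel>\<close> on the unit ball.  The expression under the square
  root is \<open>h t t = \<parallel>h t\<parallel>\<^sup>2\<close>.
\<close>
theorem intrinsic_error_eq:
  assumes rk: "reproducing_kernel_hilbert_space K (fst (rkhs K)) (snd (rkhs K))"
    and K: "\<And>s t. K s t = r (s - t)" and r: "continuous_on UNIV r"
    and c: "\<And>j. j \<in> J n \<Longrightarrow> continuous_on UNIV (c j)"
    and normal: "\<And>t k. k \<in> J n \<Longrightarrow>
      (\<Sum>j\<in>J n. c j t * K (of_int j) (of_int k)) = K t (of_int k)"
  shows "intrinsic_error n K =
    (SUP t\<in>{0<..<1}. ennreal (sqrt (Re (K t t - (\<Sum>j\<in>J n. c j t * K (of_int j) t)))))"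
proof -
  interpret reproducing_kernel_hilbert_space K "fst (rkhs K)" "snd (rkhs K)" by (rule rk)
  define h where "h t s = K t s - (\<Sum>j\<in>J n. c j t * K (of_int j) s)" for t s
  have h_mem: "h t \<in> fst (rkhs K)" for t
    unfolding h_def by (intro diff_in combination_in kernel_mem finite_J)
  have h_zero: "h t (of_int k) = 0" if "k \<in> J n" for t k
    using normal[OF that] by (simp add: h_def)
  have h_nrm: "nrm (h t) = sqrt (Re (h t t))" for t
  proof -
    have "nrm (h t) = sqrt (Re (snd (rkhs K) (K t) (K t) - (\<Sum>i\<in>J n. c i t * snd (rkhs K) (K (of_int i)) (K t))))"
      unfolding h_def
    proof (rule nrm_orthogonal_residual)
      fix k assume "k \<in> J n"
      then have "snd (rkhs K) (h t) (K (of_int k)) = 0"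
        using h_zero[of k t] reproducing[OF h_mem[of t], of "of_int k"] by simp
      then show "snd (rkhs K) (\<lambda>s. K t s - (\<Sum>i\<in>J n. c i t * K (real_of_int i) s)) (K (of_int k)) = 0"
        unfolding h_def .
    qed (simp_all add: kernel_mem finite_J)
    then show ?thesis by (simp add: kernel_ip h_def)
  qed
  have goal: "intrinsic_error n K = (SUP t\<in>{0<..<1}. ennreal (nrm (h t)))"
  proof (rule antisym)
    define A where "A v t = (\<Sum>j\<in>J n. cnj (c j t) * v j)" for v :: "int \<Rightarrow> complex" and t
    have A_cont: "continuous_on UNIV (A v)" for v
      unfolding A_def by (intro continuous_intros c)
    have "A \<in> (J n \<rightarrow>\<^sub>E UNIV) \<rightarrow> Linf"
    proof
      fix v
      have "compact (A v ` {0..1})"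
        by (intro compact_continuous_image continuous_on_subset[OF A_cont]) auto
      then obtain B where B: "\<And>t. t \<in> {0..1} \<Longrightarrow> norm (A v t) \<le> B"
        using bounded_iff compact_imp_bounded by (metis image_eqI)
      have "Linf_norm (A v) \<le> ennreal B"
        by (intro Linf_norm_le continuous_measurable_unit_interval A_cont AE_I2)
          (simp add: B ennreal_leI)
      then show "A v \<in> Linf"
        by (simp add: Linf_def continuous_measurable_unit_interval A_cont order.strict_trans1)
    qed
    then have "intrinsic_error n K \<le> recovery_error n A K"
      unfolding intrinsic_error_def by (rule INF_lower)
    also have "\<dots> \<le> (SUP t\<in>{0<..<1}. ennreal (nrm (h t)))"
      unfolding recovery_error_def
    proof (rule SUP_least)
      fix f assume "f \<in> rkhs_unit_ball K"
      then have f: "f \<in> fst (rkhs K)" "nrm f \<le> 1"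
        by (simp_all add: rkhs_unit_ball_def nrm_def)
      let ?v = "restrict (\<lambda>j. f (of_int j)) (J n)"
      have residual: "f t - A ?v t = snd (rkhs K) f (h t)" for t
      proof -
        have "snd (rkhs K) f (h t) = f t - (\<Sum>j\<in>J n. cnj (c j t) * f (of_int j))"
          unfolding h_def
          by (simp add: ip_diff_right ip_combination_right combination_in kernel_mem finite_J f(1)
              reproducing[OF f(1), symmetric])
        then show ?thesis by (simp add: A_def)
      qed
      show "Linf_norm (\<lambda>t. f t - A ?v t) \<le> (SUP t\<in>{0<..<1}. ennreal (nrm (h t)))"
      proof (rule Linf_norm_le)
        show "(\<lambda>t. f t - A ?v t) \<in> borel_measurable (lebesgue_on {0..1})"
          by (intro continuous_measurable_unit_interval continuous_intros A_cont rkhs_member_continuous[OF rk K r f(1)])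
        show "AE t in lebesgue_on {0..1}. ennreal (norm (f t - A ?v t)) \<le> (SUP t\<in>{0<..<1}. ennreal (nrm (h t)))"
          using AE_unit_interval_interior
        proof eventually_elim
          fix t :: real assume t: "t \<in> {0<..<1}"
          have "norm (f t - A ?v t) \<le> nrm f * nrm (h t)"
            unfolding residual by (rule Cauchy_Schwarz[OF f(1) h_mem])
          also have "\<dots> \<le> nrm (h t)"
            using mult_right_mono[OF f(2) nrm_nonneg[OF h_mem]] by simp
          finally show "ennreal (norm (f t - A ?v t)) \<le> (SUP t\<in>{0<..<1}. ennreal (nrm (h t)))"
            by (intro SUP_upper2[OF t] ennreal_leI)
        qed
      qed
    qed
    finally show "intrinsic_error n K \<le> (SUP t\<in>{0<..<1}. ennreal (nrm (h t)))" .
  next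
    show "(SUP t\<in>{0<..<1}. ennreal (nrm (h t))) \<le> intrinsic_error n K"
      unfolding intrinsic_error_def
    proof (intro SUP_least INF_greatest)
      fix t :: real and A assume t: "t \<in> {0<..<1}"
      show "ennreal (nrm (h t)) \<le> recovery_error n A K"
      proof (cases "nrm (h t) = 0")
        case False
        then have pos: "nrm (h t) > 0" using nrm_nonneg[OF h_mem, of t] by simp
        define a where "a = complex_of_real (1 / nrm (h t))"
        let ?f = "\<lambda>s. a * h t s"
        have f_mem: "?f \<in> fst (rkhs K)" by (rule scale_in[OF h_mem])
        have "nrm ?f = 1" using pos nrm_scale[OF h_mem, of a t] by (simp add: a_def norm_divide)
        then have ball: "?f \<in> rkhs_unit_ball K"
          using f_mem by (simp add: rkhs_unit_ball_def nrm_def)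
        have "ennreal (norm (?f t)) \<le> recovery_error n A K"
          by (rule recovery_error_ge[OF rk ball rkhs_member_continuous[OF rk K r f_mem] _ t])
            (simp add: h_zero)
        moreover have "nrm (h t) \<le> norm (?f t)"
        proof -
          have "(nrm (h t))\<^sup>2 = Re (h t t)"
            using h_nrm[of t] pos by (metis real_sqrt_pow2_iff real_sqrt_gt_0_iff less_imp_le)
          also have "\<dots> \<le> norm (h t t)" by (rule complex_Re_le_cmod)
          finally have "nrm (h t) * nrm (h t) \<le> norm (h t t)" by (simp add: power2_eq_square)
          then show ?thesis using pos by (simp add: a_def norm_mult norm_divide pos_le_divide_eq)
        qed
        ultimately show ?thesis by (meson ennreal_leI order.trans)
      qed simp
    qed
  qed
  show ?thesis
    unfolding goal h_nrm h_def ..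
qed

section \<open>Optimal approximation of a stationary process\<close>

theorem proposition2p1:
  fixes \<delta> :: real and n :: nat
    and M :: "'w measure" and X :: "real \<Rightarrow> 'w \<Rightarrow> complex"
  assumes "0 < \<delta>" and "\<delta> < pi" and "n \<ge> 1"
    and "prob_space M"
    and "wide_sense_stationary M X"
    and "(\<lambda>t. autocorrelation M X t 0) \<in> paley_wiener \<delta>"
    and "\<exists>t. autocorrelation M X t 0 \<noteq> 0"
  shows "invertible_mat (kernel_matrix n (autocorrelation M X)) \<and>
    (\<forall>c :: int \<Rightarrow> real \<Rightarrow> complex.
       optimal_coefficients M X n c \<longleftrightarrow>
       (\<forall>t\<in>{0<..<1}.
          row_on_J n (\<lambda>j. c j t) =
          row_on_J n (\<lambda>j. autocorrelation M X t (of_int j)) *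
          matrix_inverse (kernel_matrix n (autocorrelation M X)))) \<and>
    (\<forall>c :: int \<Rightarrow> real \<Rightarrow> complex.
       optimal_coefficients M X n c \<longrightarrow>
       (SUP t\<in>{0<..<1}. ennreal (approximation_error M X n (\<lambda>j. c j t) t)) =
       intrinsic_error n (autocorrelation M X))"
proof -
  define K where "K = autocorrelation M X"
  define r where "r t = K t 0" for t
  let ?G = "kernel_matrix n K"
  have X: "square_integrable M (X t)" for t
    using assms(5) by (simp add: wide_sense_stationary_def)
  have r_cont: "continuous_on UNIV r" and r_sq: "square_integrable lborel r"
    using assms(6) unfolding paley_wiener_def r_def K_def by blast+
  have K_r: "K s t = r (s - t)" for s t
    using assms(5) unfolding wide_sense_stationary_def K_def r_def by (metis diff_zero)
  have K_ip: "K s t = L2_inner M (X s) (X t)" for s t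
    by (simp add: K_def autocorrelation_eq_L2_inner)
  have det: "Determinant.det ?G \<noteq> 0"
    unfolding K_def
    by (rule det_kernel_matrix_nonzero[OF X])
      (rule samples_independent[OF assms(5) r_cont[unfolded r_def K_def] r_sq[unfolded r_def K_def] assms(7)])
  note inv = matrix_inverse[OF kernel_matrix_carrier det]
  have invertible: "invertible_mat ?G"
    unfolding invertible_mat_def inverts_mat_def
    using inv kernel_matrix_carrier[of n K] by auto
  \<comment> \<open>The optimal coefficients as given by the matrix formula, but for every real \<open>t\<close>: this makes them continuous functions on the whole line.\<close>
  define c0 where "c0 j t = (\<Sum>k<2 * n. K t (of_int (J_elem n k)) *
    matrix_inverse ?G $$ (k, nat (j + int n - 1)))" for j t
  have c0_row: "row_on_J n (\<lambda>j. c0 j t) = row_on_J n (\<lambda>j. K t (of_int j)) * matrix_inverse ?G" for t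
    by (rule eq_matI)
      (use inv(3) in \<open>auto simp: row_on_J_def c0_def scalar_prod_def atLeast0LessThan J_elem_def\<close>)
  have c0: "(\<Sum>j\<in>J n. c0 j t * K (of_int j) (of_int k)) = K t (of_int k)" if "k \<in> J n" for t k
    using c0_row[of t] that unfolding row_eq_mult_inverse_iff[OF det] by (rule bspec)
  have c0_cont: "continuous_on UNIV (c0 j)" for j
    unfolding c0_def K_r
    by (intro continuous_intros continuous_on_compose2[OF r_cont]) auto
  have orth_iff: "L2_inner M (\<lambda>\<omega>. X t \<omega> - (\<Sum>j\<in>J n. a j * X (of_int j) \<omega>)) (X (of_int k)) = 0 \<longleftrightarrow>
      (\<Sum>j\<in>J n. a j * K (of_int j) (of_int k)) = K t (of_int k)" for a t k
    using L2.combination_in[of "J n" "\<lambda>j. X (of_int j)" M a]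
    by (auto simp: L2.ip_diff_left L2.ip_combination_left finite_J X K_ip)
  have best: "(\<forall>a. approximation_error M X n v t \<le> approximation_error M X n a t) \<longleftrightarrow>
      row_on_J n v = row_on_J n (\<lambda>j. K t (of_int j)) * matrix_inverse ?G" for v t
    unfolding approximation_error_def row_eq_mult_inverse_iff[OF det] orth_iff[symmetric]
    by (rule L2.best_approximation_iff[where ?c0.0 = "\<lambda>j. c0 j t"])
      (simp_all add: finite_J X orth_iff c0)
  then have optimal_iff: "optimal_coefficients M X n c \<longleftrightarrow>
      (\<forall>t\<in>{0<..<1}. row_on_J n (\<lambda>j. c j t) = row_on_J n (\<lambda>j. K t (of_int j)) * matrix_inverse ?G)" for c
    unfolding optimal_coefficients_def by blast
  have error_c0: "approximation_error M X n (\<lambda>j. c0 j t) t =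
      sqrt (Re (K t t - (\<Sum>j\<in>J n. c0 j t * K (of_int j) t)))" for t
    unfolding approximation_error_def K_ip
    by (rule L2.nrm_orthogonal_residual) (simp_all add: finite_J X orth_iff c0)
  have error: "(SUP t\<in>{0<..<1}. ennreal (approximation_error M X n (\<lambda>j. c j t) t)) = intrinsic_error n K"
    if c: "optimal_coefficients M X n c" for c
  proof -
    have "approximation_error M X n (\<lambda>j. c j t) t = approximation_error M X n (\<lambda>j. c0 j t) t"
      if t: "t \<in> {0<..<1}" for t
    proof (rule antisym)
      show "approximation_error M X n (\<lambda>j. c j t) t \<le> approximation_error M X n (\<lambda>j. c0 j t) t"
        using c t by (simp add: optimal_coefficients_def)
      show "approximation_error M X n (\<lambda>j. c0 j t) t \<le> approximation_error M X n (\<lambda>j. c j t) t"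
        using best[of "\<lambda>j. c0 j t" t] c0_row[of t] by blast
    qed
    then show ?thesis
      using intrinsic_error_eq[OF L2_rkhs[of M X, OF X, folded K_def] K_r r_cont c0_cont c0]
      by (simp add: error_c0)
  qed
  show ?thesis
    using invertible optimal_iff error unfolding K_def by blast
qed

end
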